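(* Let $x = P(x)$ be a PPS in simple normal form with $n$ variables and LFP $q^*$ satisfying $\mathbf{0} < q^* < \mathbf{1}$, and let $r = a/b \in (0,1]$ with $a,b$ positive integers. Let $g= 32 |P| + 4 + 6 n + 56 (\lceil \log n \rceil + \lceil \log |P| \rceil + \lceil \log \log b \rceil)$ and $m := 2 + 3n +28 (\lceil \log n \rceil + \lceil \log |P| \rceil + \lceil \log \log b \rceil)$ (logarithms base $2$). Let $x^{(i)}$ denote the $i$-th Newton iterate for $x=P(x)$ starting at $x^{(0)}:=\mathbf{0}$. Then for every $k \in \{1, \ldots, n\}$: (1) $q^*_k > r$ if and only if $x^{(g)}_k > r$; (2) $q^*_k < r$ if and only if $x^{(g)}_k + 2 \cdot 2^{-2^m} < r$.
   Context: A PPS is a system $x_i = P_i(x)$, $i=1,\dots,n$, with each $P_i$ a polynomial with nonnegative rational coefficients (including constant term) summing to at most $1$; its LFP $q^*$ is the coordinatewise least nonnegative solution. Simple normal form: each $P_i$ is either $x_jx_k$ or linear $\sum_j p_{i,j}x_j+p_{i,0}$. $|P|$ is $n$ plus the total number of bits of all nonzero coefficients (binary numerator/denominator) and nonzero exponents. Newton iterates: $x^{(k+1)} := x^{(k)} + (I-B(x^{(k)}))^{-1}(P(x^{(k)})-x^{(k)})$, where $B$ is the Jacobian of $P$. *)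

theory Defs
  imports "HOL-Analysis.Analysis" "HOL-Library.Poly_Mapping" "HOL-Library.Log_Nat"
begin

text \<open>
  The variables \<open>x\<^sub>1, \<dots>, x\<^sub>n\<close> are indexed by a finite type \<open>'n\<close> with \<open>n = CARD('n)\<close>.  A monomial is the
  finitely supported map of its exponents; a polynomial maps monomials to coefficients.
\<close>

type_synonym 'n monomial = "'n \<Rightarrow>\<^sub>0 nat"
type_synonym 'n rat_poly = "'n monomial \<Rightarrow>\<^sub>0 rat"
type_synonym 'n system = "'n rat_poly ^ 'n"

definition eval_monomial :: "'n::finite monomial \<Rightarrow> real ^ 'n \<Rightarrow> real" where
  "eval_monomial m x = (\<Prod>j\<in>UNIV. (x $ j) ^ Poly_Mapping.lookup m j)"

definition eval_poly :: "'n::finite rat_poly \<Rightarrow> real ^ 'n \<Rightarrow> real" where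
  "eval_poly p x =
     (\<Sum>m\<in>Poly_Mapping.keys p. of_rat (Poly_Mapping.lookup p m) * eval_monomial m x)"

definition eval_system :: "'n::finite system \<Rightarrow> real ^ 'n \<Rightarrow> real ^ 'n" where
  "eval_system P x = (\<chi> i. eval_poly (P $ i) x)"

text \<open>Probabilistic polynomial system.\<close>

definition is_PPS :: "'n::finite system \<Rightarrow> bool" where
  "is_PPS P \<longleftrightarrow> (\<forall>i.
     (\<forall>m. 0 \<le> Poly_Mapping.lookup (P $ i) m) \<and>
     (\<Sum>m\<in>Poly_Mapping.keys (P $ i). Poly_Mapping.lookup (P $ i) m) \<le> 1)"

definition var :: "'n::finite \<Rightarrow> 'n monomial" where
  "var j = Poly_Mapping.single j 1"

text \<open>The case \<open>j = k\<close>, i.e. \<open>x\<^sub>j\<^sup>2\<close>, is allowed in the quadratic form.\<close>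

definition simple_normal_form :: "'n::finite system \<Rightarrow> bool" where
  "simple_normal_form P \<longleftrightarrow> (\<forall>i.
     (\<exists>j k. P $ i = Poly_Mapping.single (var j + var k) 1) \<or>
     (\<exists>p p\<^sub>0. P $ i = (\<Sum>j\<in>UNIV. Poly_Mapping.single (var j) (p j)) + Poly_Mapping.single 0 p\<^sub>0))"

definition is_LFP :: "'n::finite system \<Rightarrow> real ^ 'n \<Rightarrow> bool" where
  "is_LFP P q \<longleftrightarrow>
     (\<forall>i. 0 \<le> q $ i) \<and> eval_system P q = q \<and>
     (\<forall>y. (\<forall>i. 0 \<le> y $ i) \<and> eval_system P y = y \<longrightarrow> (\<forall>i. q $ i \<le> y $ i))"

text \<open>
  Encoding size.  Rationals are written in lowest terms with positive denominator, and
  \<open>bitlen k\<close> is the length of the binary representation of \<open>k > 0\<close>.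
\<close>

definition rat_size :: "rat \<Rightarrow> nat" where
  "rat_size c = nat (bitlen \<bar>fst (quotient_of c)\<bar>) + nat (bitlen (snd (quotient_of c)))"

definition monomial_size :: "'n monomial \<Rightarrow> nat" where
  "monomial_size m = (\<Sum>j\<in>Poly_Mapping.keys m. nat (bitlen (int (Poly_Mapping.lookup m j))))"

definition system_size :: "'n::finite system \<Rightarrow> nat" where
  "system_size P = CARD('n) +
     (\<Sum>i\<in>UNIV. \<Sum>m\<in>Poly_Mapping.keys (P $ i).
        rat_size (Poly_Mapping.lookup (P $ i) m) + monomial_size m)"

definition newton_step :: "'n::finite system \<Rightarrow> real ^ 'n \<Rightarrow> real ^ 'n" where
  "newton_step P x =
     x + matrix_inv (mat 1 - jacobian (eval_system P) (at x)) *v (eval_system P x - x)"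

definition newton_iterate :: "'n::finite system \<Rightarrow> nat \<Rightarrow> real ^ 'n" where
  "newton_iterate P k = (newton_step P ^^ k) 0"

definition ceil_log :: "nat \<Rightarrow> int" where
  "ceil_log k = \<lceil>log 2 (real k)\<rceil>"

text \<open>\<open>log log 1\<close> is undefined; the value \<open>0\<close> is used for it.\<close>

definition ceil_log_log :: "nat \<Rightarrow> int" where
  "ceil_log_log b = (if b \<le> 1 then 0 else \<lceil>log 2 (log 2 (real b))\<rceil>)"

end

theory Submission
  imports Defs "HOL-Computational_Algebra.Polynomial"
begin

text \<open>
  Put \<open>u = 1 - q\<close>.  If \<open>t (q - x) \<le> u\<close> for an iterate \<open>0 \<le> x \<le> q\<close>, the next iterate \<open>x'\<close> satisfies
  \<open>((1 + t)\<^sup>2 - 1) (q - x') \<le> u\<close>, because \<open>(I - B x) u\<close> dominates the quadratic error term and \<open>I - B x\<close>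
  has a nonnegative inverse.  So \<open>k\<close> steps from \<open>0\<close> give \<open>((1 + t) ^ 2 ^ k - 1) (q - x) \<le> u\<close> for every
  \<open>t \<le> u\<close>, which describes the linear and the quadratic phase at once.  Cramer's rule at a vertex of
  the linearised inequalities for \<open>u\<close> shows \<open>u \<ge> 2 ^ - (4 |P|)\<close>.

  For the distance of \<open>q\<^sub>k\<close> from \<open>a / b\<close>, deform the system to \<open>(1 + \<epsilon>) x\<^sub>i = P\<^sub>i x + \<epsilon> x\<^sub>i\<^sup>3\<close>, which has
  solutions \<open>q \<epsilon> \<le> q\<close> tending to \<open>q\<close>.  For these, multiplication by \<open>x\<^sub>k\<close> acts on the \<open>3 ^ n\<close> monomials with
  exponents below \<open>3\<close> by a matrix over \<open>\<int>[\<epsilon>]\<close>.  The lowest coefficient in \<open>\<epsilon>\<close> of its characteristic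
  polynomial at \<open>b x\<^sub>k - a\<close> is an integer polynomial with root \<open>b q\<^sub>k - a\<close>, and its lowest nonzero
  coefficient is at least \<open>1\<close> in absolute value.
\<close>

section \<open>Norms and integrality of determinants\<close>

text \<open>Kept abstract because it is used at three levels: for \<open>abs\<close> on the reals,
  for \<open>poly_norm abs\<close>, and for the norm of bivariate polynomials obtained by applying
  \<open>poly_norm\<close> twice.\<close>

locale submultiplicative =
  fixes \<nu> :: "'a::comm_ring_1 \<Rightarrow> real"
  assumes zero: "\<nu> 0 = 0" and one: "\<nu> 1 \<le> 1" and nonneg: "0 \<le> \<nu> x" and minus: "\<nu> (- x) = \<nu> x"
    and add: "\<nu> (x + y) \<le> \<nu> x + \<nu> y" and mult: "\<nu> (x * y) \<le> \<nu> x * \<nu> y"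
begin

lemma diff: "\<nu> (x - y) \<le> \<nu> x + \<nu> y"
  using add[of x "- y"] minus[of y] by simp

lemma sum: "\<nu> (\<Sum>i\<in>I. f i) \<le> (\<Sum>i\<in>I. \<nu> (f i))"
  by (induction I rule: infinite_finite_induct) (auto simp: zero intro: order_trans[OF add])

lemma prod: "\<nu> (\<Prod>i\<in>I. f i) \<le> (\<Prod>i\<in>I. \<nu> (f i))"
  by (induction I rule: infinite_finite_induct)
    (auto simp: one nonneg intro!: order_trans[OF mult] mult_left_mono)

text \<open>In the Leibniz expansion, passing from permutations to all functions only adds
  nonnegative products, and the enlarged sum factors into row sums.\<close>

lemma det: "\<nu> (det A) \<le> (\<Prod>i\<in>UNIV. \<Sum>j\<in>UNIV. \<nu> (A $ i $ j))" for A :: "'a ^ 'n ^ 'n"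
proof -
  have "\<nu> (of_int (sign f) * x) \<le> \<nu> x" for x and f :: "'n \<Rightarrow> 'n"
    by (simp add: sign_def minus)
  then have "\<nu> (det A) \<le> (\<Sum>f | f permutes UNIV. \<Prod>i\<in>UNIV. \<nu> (A $ i $ f i))"
    unfolding det_def by (intro order_trans[OF sum] sum_mono) (rule order_trans[OF _ prod])
  also have "\<dots> \<le> (\<Sum>f\<in>UNIV. \<Prod>i\<in>UNIV. \<nu> (A $ i $ f i))"
    by (intro sum_mono2 prod_nonneg) (auto simp: nonneg)
  also have "\<dots> = (\<Prod>i\<in>UNIV. \<Sum>j\<in>UNIV. \<nu> (A $ i $ j))"
    using prod_sum_PiE[of UNIV "\<lambda>_. UNIV" "\<lambda>i j. \<nu> (A $ i $ j)"] by simp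
  finally show ?thesis .
qed

end

definition poly_norm :: "('a::comm_ring_1 \<Rightarrow> real) \<Rightarrow> 'a poly \<Rightarrow> real" where
  "poly_norm \<nu> p = (\<Sum>i\<le>degree p. \<nu> (coeff p i))"

context submultiplicative
begin

lemma poly_norm_eq: "degree p \<le> n \<Longrightarrow> poly_norm \<nu> p = (\<Sum>i\<le>n. \<nu> (coeff p i))"
  unfolding poly_norm_def by (rule sum.mono_neutral_left) (auto simp: coeff_eq_0 zero)

lemma poly_norm_nonneg: "0 \<le> poly_norm \<nu> p"
  by (simp add: poly_norm_def sum_nonneg nonneg)

lemma poly_norm_0: "poly_norm \<nu> 0 = 0"
  by (simp add: poly_norm_def zero)

lemma poly_norm_pCons: "poly_norm \<nu> (pCons a p) = \<nu> a + poly_norm \<nu> p"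
  by (subst poly_norm_eq[of _ "Suc (degree p)"])
    (simp_all add: degree_pCons_le poly_norm_def sum.atMost_Suc_shift del: sum.atMost_Suc)

lemma poly_norm_add: "poly_norm \<nu> (p + q) \<le> poly_norm \<nu> p + poly_norm \<nu> q"
  by (subst (1 2 3) poly_norm_eq[of _ "max (degree p) (degree q)"])
    (auto simp: degree_add_le add sum.distrib[symmetric] intro: sum_mono)

lemma poly_norm_smult: "poly_norm \<nu> (smult a p) \<le> \<nu> a * poly_norm \<nu> p"
  by (subst (1 2) poly_norm_eq[of _ "degree p"])
    (auto simp: degree_smult_le mult sum_distrib_left intro: sum_mono)

lemma poly_norm_mult: "poly_norm \<nu> (p * q) \<le> poly_norm \<nu> p * poly_norm \<nu> q"
proof (induction p)
  case (pCons a p)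
  have "poly_norm \<nu> (pCons a p * q) \<le> poly_norm \<nu> (smult a q) + poly_norm \<nu> (p * q)"
    using poly_norm_add[of "smult a q" "pCons 0 (p * q)"] by (simp add: poly_norm_pCons zero)
  then show ?case using pCons.IH poly_norm_smult[of a q] by (simp add: poly_norm_pCons algebra_simps)
qed (simp add: poly_norm_0)

lemma poly_norm_coeff: "\<nu> (coeff p i) \<le> poly_norm \<nu> p"
proof (cases "i \<le> degree p")
  case True
  then show ?thesis unfolding poly_norm_def
    by (intro member_le_sum[of i "{..degree p}" "\<lambda>i. \<nu> (coeff p i)"]) (auto simp: nonneg)
qed (simp add: coeff_eq_0 zero poly_norm_nonneg)

lemma poly_norm_monom: "poly_norm \<nu> (monom a k) = \<nu> a"
  by (induction k) (simp_all add: monom_0 monom_Suc poly_norm_pCons poly_norm_0 zero)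

lemma submultiplicative_poly_norm: "submultiplicative (poly_norm \<nu>)"
proof
  show "poly_norm \<nu> 1 \<le> 1" using one by (simp add: poly_norm_def)
  show "poly_norm \<nu> (- p) = poly_norm \<nu> p" for p by (simp add: poly_norm_def minus)
qed (rule poly_norm_0 poly_norm_nonneg poly_norm_add poly_norm_mult)+

text \<open>The inclusion of the coefficient ranges is what carries integrality over to the
  quotient.\<close>

lemma split_off_lowest_power:
  assumes "p \<noteq> 0"
  obtains s q where "p = monom 1 s * q" "coeff q 0 \<noteq> 0" "poly_norm \<nu> q = poly_norm \<nu> p"
    "range (coeff q) \<subseteq> range (coeff p)"
  using assms
proof (induction p arbitrary: thesis)
  case (pCons a p)
  show ?case
  proof (cases "a = 0")
    case True
    then have "p \<noteq> 0" using pCons.prems by simp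
    then obtain s q where "p = monom 1 s * q" "coeff q 0 \<noteq> 0" "poly_norm \<nu> q = poly_norm \<nu> p"
        "range (coeff q) \<subseteq> range (coeff p)"
      using pCons.IH by metis
    moreover have "range (coeff p) \<subseteq> range (coeff (pCons a p))"
      by (auto simp: image_iff) (metis coeff_pCons_Suc)
    ultimately show ?thesis using True
      by (intro pCons.prems(1)[of "Suc s" q]) (auto simp: monom_Suc poly_norm_pCons zero)
  next
    case False
    then show ?thesis by (intro pCons.prems(1)[of 0 "pCons a p"]) (auto simp: monom_0)
  qed
qed simp

end

lemma submultiplicative_abs: "submultiplicative (abs :: real \<Rightarrow> real)"
  by unfold_locales (auto simp: abs_mult)

interpretation real_abs: submultiplicative "abs :: real \<Rightarrow> real"
  by (rule submultiplicative_abs)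

interpretation poly_abs: submultiplicative "poly_norm (abs :: real \<Rightarrow> real)"
  by (rule real_abs.submultiplicative_poly_norm)

interpretation bipoly_abs: submultiplicative "poly_norm (poly_norm (abs :: real \<Rightarrow> real))"
  by (rule poly_abs.submultiplicative_poly_norm)

text \<open>The counterpart of \<open>submultiplicative\<close> for integrality:
  \<open>polys_over\<close> applied twice to \<int> singles out the integer polynomials inside
  \<open>real poly poly\<close>, so that norms and integrality apply to the same
  determinant.\<close>

locale subring =
  fixes R :: "'a::comm_ring_1 set"
  assumes zero: "0 \<in> R" and one: "1 \<in> R" and minus: "x \<in> R \<Longrightarrow> - x \<in> R"
    and add: "x \<in> R \<Longrightarrow> y \<in> R \<Longrightarrow> x + y \<in> R" and mult: "x \<in> R \<Longrightarrow> y \<in> R \<Longrightarrow> x * y \<in> R"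
begin

lemma diff: "x \<in> R \<Longrightarrow> y \<in> R \<Longrightarrow> x - y \<in> R"
  using add[of x "- y"] minus[of y] by simp

lemma sum: "(\<And>i. i \<in> I \<Longrightarrow> f i \<in> R) \<Longrightarrow> (\<Sum>i\<in>I. f i) \<in> R"
  by (induction I rule: infinite_finite_induct) (auto simp: zero add)

lemma prod: "(\<And>i. i \<in> I \<Longrightarrow> f i \<in> R) \<Longrightarrow> (\<Prod>i\<in>I. f i) \<in> R"
  by (induction I rule: infinite_finite_induct) (auto simp: one mult)

lemma det: "(\<And>i j. A $ i $ j \<in> R) \<Longrightarrow> det A \<in> R"
  unfolding det_def by (intro sum mult prod) (auto simp: sign_def one minus)

end

definition polys_over :: "'a::comm_ring_1 set \<Rightarrow> 'a poly set" where
  "polys_over R = {p. \<forall>i. coeff p i \<in> R}"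

context subring
begin

lemma pCons_polys_over: "pCons a p \<in> polys_over R \<longleftrightarrow> a \<in> R \<and> p \<in> polys_over R"
  unfolding polys_over_def mem_Collect_eq by (metis coeff_pCons_0 coeff_pCons_Suc not0_implies_Suc)

lemma zero_polys_over: "0 \<in> polys_over R"
  by (simp add: polys_over_def zero)

lemma monom_polys_over: "a \<in> R \<Longrightarrow> monom a k \<in> polys_over R"
  by (simp add: polys_over_def zero)

lemma subring_polys_over: "subring (polys_over R)"
proof
  show "p * q \<in> polys_over R" if "p \<in> polys_over R" "q \<in> polys_over R" for p q
    using that by (auto simp: polys_over_def coeff_mult intro!: sum mult)
qed (auto simp: polys_over_def zero one minus add coeff_1)

end

lemma subring_Ints: "subring (\<int> :: real set)"
  by unfold_locales auto

interpretation ints: subring "\<int> :: real set"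
  by (rule subring_Ints)

interpretation int_polys: subring "polys_over (\<int> :: real set)"
  by (rule ints.subring_polys_over)

interpretation int_bipolys: subring "polys_over (polys_over (\<int> :: real set))"
  by (rule int_polys.subring_polys_over)

text \<open>The outer indeterminate is \<epsilon>, the inner one \<open>y\<close>; with this nesting
  the lowest coefficient in \<epsilon> is itself a polynomial in \<open>y\<close>.\<close>

definition eval2 :: "real poly poly \<Rightarrow> real \<Rightarrow> real \<Rightarrow> real" where
  "eval2 D \<epsilon> y = poly (poly D [:\<epsilon>:]) y"

lemma eval2_simps [simp]:
  "eval2 0 \<epsilon> y = 0" "eval2 (D + E) \<epsilon> y = eval2 D \<epsilon> y + eval2 E \<epsilon> y"
  "eval2 (D - E) \<epsilon> y = eval2 D \<epsilon> y - eval2 E \<epsilon> y"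
  "eval2 (D * E) \<epsilon> y = eval2 D \<epsilon> y * eval2 E \<epsilon> y"
  "eval2 (pCons f D) \<epsilon> y = poly f y + \<epsilon> * eval2 D \<epsilon> y"
  "eval2 (smult f D) \<epsilon> y = poly f y * eval2 D \<epsilon> y"
  "eval2 (monom f k) \<epsilon> y = poly f y * \<epsilon> ^ k"
  by (simp_all add: eval2_def poly_monom poly_power)

lemma eval2_sum: "eval2 (\<Sum>i\<in>I. f i) \<epsilon> y = (\<Sum>i\<in>I. eval2 (f i) \<epsilon> y)"
  by (simp add: eval2_def poly_sum)

lemma eval2_prod: "eval2 (\<Prod>i\<in>I. f i) \<epsilon> y = (\<Prod>i\<in>I. eval2 (f i) \<epsilon> y)"
  by (simp add: eval2_def poly_prod)

lemma eval2_det: "eval2 (det A) \<epsilon> y = det (\<chi> i j. eval2 (A $ i $ j) \<epsilon> y)"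
proof -
  have "eval2 (of_int (sign f) * D) \<epsilon> y = of_int (sign f) * eval2 D \<epsilon> y" for f :: "'a \<Rightarrow> 'a" and D
    by (simp add: sign_def eval2_def)
  then show ?thesis unfolding det_def eval2_sum eval2_prod[symmetric] by (simp add: eval2_prod del: eval2_simps)
qed

lemma tendsto_eval2:
  assumes "(e \<longlongrightarrow> e0) G" "(f \<longlongrightarrow> f0) G"
  shows "((\<lambda>j. eval2 D (e j) (f j)) \<longlongrightarrow> eval2 D e0 f0) G"
  by (induction D) (auto intro!: tendsto_intros assms)

section \<open>Root bounds for integer polynomials\<close>

lemma abs_poly_le: "\<bar>y\<bar> \<le> 1 \<Longrightarrow> \<bar>poly p y\<bar> \<le> poly_norm abs p" for p :: "real poly"
proof (induction p)
  case (pCons a p)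
  have "\<bar>y\<bar> * \<bar>poly p y\<bar> \<le> 1 * \<bar>poly p y\<bar>" using pCons by (intro mult_right_mono) auto
  then have "\<bar>y * poly p y\<bar> \<le> poly_norm abs p" using pCons by (simp add: abs_mult)
  then show ?case by (simp add: real_abs.poly_norm_pCons)
qed (simp add: real_abs.poly_norm_0)

text \<open>Once the lowest power is split off, the constant coefficient \<open>a\<close> is a
  nonzero integer, and at the root it equals \<open>- (y * poly q' y)\<close>; so a small
  \<bar>y\<bar> forces a large norm.\<close>

lemma integer_poly_root_bound:
  fixes p :: "real poly"
  assumes "p \<noteq> 0" "p \<in> polys_over \<int>" "poly p y = 0" "y \<noteq> 0" "\<bar>y\<bar> \<le> 1"
  shows "1 \<le> \<bar>y\<bar> * poly_norm abs p"
proof -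
  obtain s q where q: "p = monom 1 s * q" "coeff q 0 \<noteq> 0" "poly_norm abs q = poly_norm abs p"
      "range (coeff q) \<subseteq> range (coeff p)"
    using real_abs.split_off_lowest_power[OF assms(1)] by metis
  obtain a q' where q': "q = pCons a q'" by (cases q)
  have "a \<in> range (coeff p)" using q(4) q' by (metis coeff_pCons_0 rangeI subsetD)
  then have "a \<in> \<int>" "a \<noteq> 0" using assms(2) q(2) q' by (auto simp: polys_over_def)
  then have "1 \<le> \<bar>a\<bar>" by (simp add: Ints_nonzero_abs_ge1)
  also have "poly q y = 0" using assms(3,4) q(1) by (simp add: poly_monom)
  then have "a = - (y * poly q' y)" using q' by simp
  then have "\<bar>a\<bar> = \<bar>y\<bar> * \<bar>poly q' y\<bar>" by (simp add: abs_mult)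
  also have "\<dots> \<le> \<bar>y\<bar> * poly_norm abs q'" by (intro mult_left_mono abs_poly_le assms) auto
  also have "\<dots> \<le> \<bar>y\<bar> * poly_norm abs p"
    using q(3) q' by (intro mult_left_mono) (auto simp: real_abs.poly_norm_pCons)
  finally show ?thesis .
qed

text \<open>The lowest coefficient of \<open>D\<close> as a polynomial in \<open>\<epsilon>\<close> vanishes at the limit point.\<close>

lemma limit_root_bound:
  assumes D: "D \<noteq> 0" "D \<in> polys_over (polys_over \<int>)"
    and root: "\<And>j. eval2 D (e j) (f j) = 0" "\<And>j. 0 < e j" "e \<longlonglongrightarrow> 0" "f \<longlonglongrightarrow> y"
    and y: "y \<noteq> 0" "\<bar>y\<bar> \<le> 1"
  shows "1 \<le> \<bar>y\<bar> * poly_norm (poly_norm abs) D"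
proof -
  obtain s E where E: "D = monom 1 s * E" "coeff E 0 \<noteq> 0"
      "poly_norm (poly_norm abs) E = poly_norm (poly_norm abs) D" "range (coeff E) \<subseteq> range (coeff D)"
    using poly_abs.split_off_lowest_power[OF D(1)] by metis
  \<comment> \<open>Since \<open>e j\<close> is positive, the power of \<epsilon> can be cancelled
    before the limit is taken.\<close>
  have "eval2 E (e j) (f j) = 0" for j using root(1,2)[of j] E(1) by simp
  moreover have "(\<lambda>j. eval2 E (e j) (f j)) \<longlonglongrightarrow> eval2 E 0 y" by (intro tendsto_eval2 root)
  ultimately have "eval2 E 0 y = 0" by (simp add: LIMSEQ_const_iff)
  then have "poly (coeff E 0) y = 0" by (cases E) simp
  moreover have "coeff E 0 \<in> range (coeff D)" using E(4) by blast
  then have "coeff E 0 \<in> polys_over \<int>" using D(2) by (auto simp: polys_over_def)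
  ultimately have "1 \<le> \<bar>y\<bar> * poly_norm abs (coeff E 0)" using E(2) y by (intro integer_poly_root_bound)
  also have "\<dots> \<le> \<bar>y\<bar> * poly_norm (poly_norm abs) D"
    using poly_abs.poly_norm_coeff[of E 0] E(3) by (intro mult_left_mono) auto
  finally show ?thesis .
qed

section \<open>Separation from rationals\<close>

abbreviation coef :: "'n::finite system \<Rightarrow> 'n \<Rightarrow> 'n monomial \<Rightarrow> real" where
  "coef P i m \<equiv> of_rat (Poly_Mapping.lookup (P $ i) m)"

definition total_degree :: "'n::finite monomial \<Rightarrow> nat" where
  "total_degree m = (\<Sum>j\<in>UNIV. Poly_Mapping.lookup m j)"

lemma total_degree_add: "total_degree (m + m') = total_degree m + total_degree m'"
  by (simp add: total_degree_def lookup_add sum.distrib)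

lemma total_degree_single: "total_degree (Poly_Mapping.single i k) = k"
  by (simp add: total_degree_def lookup_single when_def)

lemma eval_monomial_add: "eval_monomial (m + m') x = eval_monomial m x * eval_monomial m' x"
  by (simp add: eval_monomial_def lookup_add power_add prod.distrib)

lemma eval_monomial_single: "eval_monomial (Poly_Mapping.single i k) x = x $ i ^ k"
proof -
  have "eval_monomial (Poly_Mapping.single i k) x = (\<Prod>j\<in>UNIV. if j = i then x $ i ^ k else 1)"
    unfolding eval_monomial_def by (intro prod.cong) (auto simp: lookup_single when_def)
  then show ?thesis by simp
qed

lemma eval_monomial_0: "eval_monomial 0 x = 1"
  by (simp add: eval_monomial_def)

lemma eval_monomial_mono:
  assumes "\<And>i. 0 \<le> x $ i" "\<And>i. x $ i \<le> y $ i"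
  shows "eval_monomial m x \<le> eval_monomial m y"
  unfolding eval_monomial_def using assms by (intro prod_mono) (auto intro: power_mono)

lemma eval_monomial_nonneg: "(\<And>i. 0 \<le> x $ i) \<Longrightarrow> 0 \<le> eval_monomial m x"
  unfolding eval_monomial_def by (intro prod_nonneg) auto

lemma continuous_on_eval_poly: "continuous_on S (eval_poly p)"
  unfolding eval_poly_def eval_monomial_def by (intro continuous_intros)

text \<open>The exponents of the monomials that survive when every cube \<open>x\<^sub>i\<^sup>3\<close> is rewritten.\<close>

definition reduced_monomial :: "('n::finite \<Rightarrow> bool option) \<Rightarrow> 'n monomial" where
  "reduced_monomial \<alpha> =
     Abs_poly_mapping (\<lambda>j. case \<alpha> j of None \<Rightarrow> 0 | Some False \<Rightarrow> 1 | Some True \<Rightarrow> 2)"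

lemma lookup_reduced_monomial:
  "Poly_Mapping.lookup (reduced_monomial \<alpha>) j = (case \<alpha> j of None \<Rightarrow> 0 | Some False \<Rightarrow> 1 | Some True \<Rightarrow> 2)"
  unfolding reduced_monomial_def by (subst Abs_poly_mapping_inverse) auto

lemma total_degree_reduced_monomial:
  "total_degree (reduced_monomial \<alpha> :: 'n::finite monomial) \<le> 2 * CARD('n)"
proof -
  have "Poly_Mapping.lookup (reduced_monomial \<alpha>) j \<le> 2" for j
    by (auto simp: lookup_reduced_monomial split: option.split bool.split)
  then show ?thesis using sum_bounded_above[of UNIV "Poly_Mapping.lookup (reduced_monomial \<alpha>)" 2]
    by (simp add: total_degree_def)
qed

text \<open>The three values of \<open>bool option\<close> encode the exponents 0, 1, 2. The reduced
  monomials thus form a finite type with \<open>3 ^ n\<close> elements, which can index a square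
  matrix.\<close>

lemma reduced_monomial_surj:
  assumes "\<And>j. Poly_Mapping.lookup \<gamma> j \<le> 2"
  obtains \<alpha> where "reduced_monomial \<alpha> = \<gamma>"
proof
  define \<alpha> where "\<alpha> j = (if Poly_Mapping.lookup \<gamma> j = 0 then None
                         else Some (Poly_Mapping.lookup \<gamma> j = 2))" for j
  have "Poly_Mapping.lookup (reduced_monomial \<alpha>) j = Poly_Mapping.lookup \<gamma> j" for j
    using assms[of j] by (auto simp: lookup_reduced_monomial \<alpha>_def split: bool.split)
  then show "reduced_monomial \<alpha> = \<gamma>" by (rule poly_mapping_eqI)
qed

text \<open>
  Adding \<open>\<epsilon> (x\<^sub>i\<^sup>3 - x\<^sub>i)\<close> keeps the system monotone with \<open>q\<close> as a post-fixed point, and makes its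
  solutions satisfy relations that rewrite every monomial into reduced ones.
\<close>

definition deformed_fixpoint :: "'n::finite system \<Rightarrow> real \<Rightarrow> real ^ 'n \<Rightarrow> bool" where
  "deformed_fixpoint P \<epsilon> x \<longleftrightarrow> (\<forall>i. (1 + \<epsilon>) * x $ i = eval_poly (P $ i) x + \<epsilon> * x $ i ^ 3)"

section \<open>Rewriting into reduced monomials and the gap bound\<close>

locale quadratic_PPS =
  fixes P :: "'n::finite system"
  assumes PPS: "is_PPS P"
    and degree_le_2: "m \<in> Poly_Mapping.keys (P $ i) \<Longrightarrow> total_degree m \<le> 2"
begin

lemma coef_nonneg: "0 \<le> coef P i m"
  using PPS by (simp add: is_PPS_def)

lemma coef_sum: "(\<Sum>m\<in>Poly_Mapping.keys (P $ i). coef P i m) \<le> 1"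
proof -
  have "of_rat (\<Sum>m\<in>Poly_Mapping.keys (P $ i). Poly_Mapping.lookup (P $ i) m) \<le> (1::real)"
    using PPS by (simp add: is_PPS_def of_rat_le_1_iff)
  then show ?thesis by (simp add: of_rat_sum)
qed

lemma eval_poly_mono:
  assumes "\<And>i. 0 \<le> x $ i" "\<And>i. x $ i \<le> y $ i"
  shows "eval_poly (P $ i) x \<le> eval_poly (P $ i) y"
  unfolding eval_poly_def by (intro sum_mono mult_left_mono coef_nonneg eval_monomial_mono assms)

lemma eval_poly_nonneg: "(\<And>i. 0 \<le> x $ i) \<Longrightarrow> 0 \<le> eval_poly (P $ i) x"
  unfolding eval_poly_def by (intro sum_nonneg mult_nonneg_nonneg coef_nonneg eval_monomial_nonneg)

text \<open>Each rewriting of \<open>\<epsilon> * x $ i ^ 3\<close> as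
  \<open>(1 + \<epsilon>) * x $ i\<close> minus the value of \<open>P $ i\<close> costs a factor
  \<epsilon>, and a factor \<open>d\<close> to keep the coefficients integral. The coefficients
  involve \<epsilon> only, which is expressed as independence of \<open>y\<close>.\<close>

definition reduction ::
    "nat \<Rightarrow> nat \<Rightarrow> 'n monomial \<Rightarrow> (('n \<Rightarrow> bool option) \<Rightarrow> real poly poly) \<Rightarrow> bool" where
  "reduction d t \<gamma> C \<longleftrightarrow>
     (\<forall>\<alpha>. C \<alpha> \<in> polys_over (polys_over \<int>)) \<and>
     (\<Sum>\<alpha>\<in>UNIV. poly_norm (poly_norm abs) (C \<alpha>)) \<le> (3 * real d) ^ t \<and>
     (\<forall>\<alpha> \<epsilon> y y'. eval2 (C \<alpha>) \<epsilon> y = eval2 (C \<alpha>) \<epsilon> y') \<and>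
     (\<forall>\<epsilon> x y. deformed_fixpoint P \<epsilon> x \<longrightarrow>
        (real d * \<epsilon>) ^ t * eval_monomial \<gamma> x =
        (\<Sum>\<alpha>\<in>UNIV. eval2 (C \<alpha>) \<epsilon> y * eval_monomial (reduced_monomial \<alpha>) x))"

lemma reductionD:
  assumes "reduction d t \<gamma> C"
  shows "C \<alpha> \<in> polys_over (polys_over \<int>)"
    and "(\<Sum>\<alpha>\<in>UNIV. poly_norm (poly_norm abs) (C \<alpha>)) \<le> (3 * real d) ^ t"
    and "deformed_fixpoint P \<epsilon> x \<Longrightarrow> (real d * \<epsilon>) ^ t * eval_monomial \<gamma> x =
        (\<Sum>\<alpha>\<in>UNIV. eval2 (C \<alpha>) \<epsilon> y * eval_monomial (reduced_monomial \<alpha>) x)"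
    and "eval2 (C \<alpha>) \<epsilon> y = eval2 (C \<alpha>) \<epsilon> y'"
  using assms unfolding reduction_def by blast+

text \<open>One rewriting replaces a cube by monomials of degree at most 2, so the total degree
  drops and \<open>t\<close> rewritings suffice. Each multiplies the norm by at most
  \<open>3 * d\<close>: \<open>2 * d\<close> comes from \<open>d * (1 + \<epsilon>)\<close>, and
  \<open>d\<close> from a coefficient sum at most 1.\<close>

lemma reduction_exists:
  fixes d :: nat
  assumes d: "0 < d" "\<And>i m. real d * coef P i m \<in> \<int>"
    and "total_degree \<gamma> \<le> t"
  shows "\<exists>C. reduction d t \<gamma> C"
  using assms(3)
proof (induction t arbitrary: \<gamma> rule: less_induct)
  case (less t)
  let ?N = "poly_norm (poly_norm (abs :: real \<Rightarrow> real))"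
  show ?case
  proof (cases "\<forall>j. Poly_Mapping.lookup \<gamma> j \<le> 2")
    case True
    then obtain \<alpha>0 where \<alpha>0: "reduced_monomial \<alpha>0 = \<gamma>" using reduced_monomial_surj by metis
    \<comment> \<open>Nothing is left to rewrite; the coefficient only supplies the factor
      \<open>(d * \<epsilon>) ^ t\<close>.\<close>
    define C where "C \<alpha> = (if \<alpha> = \<alpha>0 then monom [:real d ^ t:] t else 0)" for \<alpha>
    have "C \<alpha> \<in> polys_over (polys_over \<int>)" for \<alpha>
      by (auto simp: C_def int_polys.zero_polys_over ints.pCons_polys_over ints.zero_polys_over
          intro!: int_polys.monom_polys_over Ints_power)
    moreover have "(\<Sum>\<alpha>\<in>UNIV. ?N (C \<alpha>)) = real d ^ t"
      by (simp add: C_def if_distrib poly_abs.poly_norm_monom poly_abs.poly_norm_0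
          real_abs.poly_norm_pCons real_abs.poly_norm_0 cong: if_cong)
    moreover have "eval2 (C \<alpha>) \<epsilon> y = eval2 (C \<alpha>) \<epsilon> y'" for \<alpha> \<epsilon> y y'
      by (simp add: C_def)
    moreover have "real d ^ t \<le> (3 * real d) ^ t" by (intro power_mono) auto
    moreover have "(\<Sum>\<alpha>\<in>UNIV. eval2 (C \<alpha>) \<epsilon> y * eval_monomial (reduced_monomial \<alpha>) x) =
        (real d * \<epsilon>) ^ t * eval_monomial \<gamma> x" for \<epsilon> x y
    proof -
      have "(\<Sum>\<alpha>\<in>UNIV. eval2 (C \<alpha>) \<epsilon> y * eval_monomial (reduced_monomial \<alpha>) x) =
         (\<Sum>\<alpha>\<in>UNIV. if \<alpha> = \<alpha>0 then (real d * \<epsilon>) ^ t * eval_monomial \<gamma> x else 0)"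
        by (intro sum.cong) (auto simp: C_def \<alpha>0 power_mult_distrib)
      then show ?thesis by simp
    qed
    ultimately have "reduction d t \<gamma> C" unfolding reduction_def by auto
    then show ?thesis by blast
  next
    case False
    then obtain i where i: "3 \<le> Poly_Mapping.lookup \<gamma> i" by (auto simp: not_le Suc_le_eq numeral_eq_Suc)
    define \<gamma>' where "\<gamma>' = \<gamma> - Poly_Mapping.single i 3"
    have "Poly_Mapping.lookup (\<gamma>' + Poly_Mapping.single i 3) j = Poly_Mapping.lookup \<gamma> j" for j
      using i by (auto simp: \<gamma>'_def lookup_add lookup_minus lookup_single when_def)
    then have \<gamma>: "\<gamma> = \<gamma>' + Poly_Mapping.single i 3" by (metis poly_mapping_eqI)
    then have \<gamma>'_deg: "total_degree \<gamma>' + 3 \<le> t"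
      using less.prems by (simp add: total_degree_add total_degree_single)
    then obtain s where t: "t = Suc s" by (cases t) auto
    have "\<exists>C. reduction d s (\<gamma>' + m) C" if "total_degree m \<le> 2" for m
      by (rule less.IH) (use that \<gamma>'_deg t in \<open>auto simp: total_degree_add\<close>)
    then obtain CC where CC: "\<And>m. total_degree m \<le> 2 \<Longrightarrow> reduction d s (\<gamma>' + m) (CC m)" by metis
    let ?K = "Poly_Mapping.keys (P $ i)" and ?i = "Poly_Mapping.single i (1::nat)"
    have i2: "total_degree ?i \<le> 2" by (simp add: total_degree_single)
    define C where "C \<alpha> = [:[:real d:], [:real d:]:] * CC ?i \<alpha>
        - (\<Sum>m\<in>?K. [:[:real d * coef P i m:]:] * CC m \<alpha>)" for \<alpha>
    have const: "[:a:] \<in> polys_over \<int>" if "a \<in> \<int>" for a :: real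
      using that by (simp add: ints.pCons_polys_over ints.zero_polys_over)
    have "C \<alpha> \<in> polys_over (polys_over \<int>)" for \<alpha>
    proof -
      have "[:[:real d:], [:real d:]:] \<in> polys_over (polys_over \<int>)"
        "[:[:real d * coef P i m:]:] \<in> polys_over (polys_over \<int>)" for m
        using const[of "real d"] const[OF d(2)]
        by (simp_all add: int_polys.pCons_polys_over int_polys.zero_polys_over)
      then show ?thesis unfolding C_def
        by (intro int_bipolys.diff int_bipolys.mult int_bipolys.sum)
          (use reductionD(1)[OF CC[OF i2]] reductionD(1)[OF CC[OF degree_le_2]] in blast)+
    qed
    moreover have "(\<Sum>\<alpha>\<in>UNIV. ?N (C \<alpha>)) \<le> (3 * real d) ^ t"
    proof -
      have N2: "?N [:[:real d:], [:real d:]:] = 2 * real d"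
        by (simp add: poly_abs.poly_norm_pCons poly_abs.poly_norm_0 real_abs.poly_norm_pCons real_abs.poly_norm_0)
      have N1: "?N [:[:real d * coef P i m:]:] = real d * coef P i m" for m
        using coef_nonneg[of i m]
        by (simp add: poly_abs.poly_norm_pCons poly_abs.poly_norm_0 real_abs.poly_norm_pCons real_abs.poly_norm_0)
      have "?N (C \<alpha>) \<le> 2 * real d * ?N (CC ?i \<alpha>)
               + (\<Sum>m\<in>?K. real d * coef P i m * ?N (CC m \<alpha>))" for \<alpha>
      proof -
        have "?N (C \<alpha>) \<le> ?N ([:[:real d:], [:real d:]:] * CC ?i \<alpha>)
              + ?N (\<Sum>m\<in>?K. [:[:real d * coef P i m:]:] * CC m \<alpha>)"
          unfolding C_def by (rule bipoly_abs.diff)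
        also have "\<dots> \<le> ?N [:[:real d:], [:real d:]:] * ?N (CC ?i \<alpha>)
              + (\<Sum>m\<in>?K. ?N [:[:real d * coef P i m:]:] * ?N (CC m \<alpha>))"
          by (intro add_mono bipoly_abs.mult order_trans[OF bipoly_abs.sum] sum_mono)
        finally show ?thesis unfolding N1 N2 .
      qed
      then have "(\<Sum>\<alpha>\<in>UNIV. ?N (C \<alpha>)) \<le> (\<Sum>\<alpha>\<in>UNIV. 2 * real d * ?N (CC ?i \<alpha>)
               + (\<Sum>m\<in>?K. real d * coef P i m * ?N (CC m \<alpha>)))" by (intro sum_mono)
      also have "\<dots> = 2 * real d * (\<Sum>\<alpha>\<in>UNIV. ?N (CC ?i \<alpha>))
               + (\<Sum>m\<in>?K. real d * coef P i m * (\<Sum>\<alpha>\<in>UNIV. ?N (CC m \<alpha>)))"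
        unfolding sum.distrib sum_distrib_left
        by (rule arg_cong2[of _ _ _ _ "(+)"], rule refl, rule sum.swap)
      also have "\<dots> \<le> 2 * real d * (3 * real d) ^ s
               + (\<Sum>m\<in>?K. real d * coef P i m * (3 * real d) ^ s)"
        using reductionD(2)[OF CC[OF i2]] reductionD(2)[OF CC[OF degree_le_2]] coef_nonneg
        by (intro add_mono mult_left_mono sum_mono) auto
      also have "(\<Sum>m\<in>?K. real d * coef P i m * (3 * real d) ^ s)
               = real d * (3 * real d) ^ s * (\<Sum>m\<in>?K. coef P i m)"
        by (simp add: sum_distrib_left mult_ac)
      also have "\<dots> \<le> real d * (3 * real d) ^ s * 1" by (intro mult_left_mono coef_sum) auto
      finally show ?thesis unfolding t by (simp add: mult_ac)
    qed
    moreover have "eval2 (C \<alpha>) \<epsilon> y = eval2 (C \<alpha>) \<epsilon> y'" for \<alpha> \<epsilon> y y'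
    proof -
      have "eval2 (CC m \<alpha>) \<epsilon> y = eval2 (CC m \<alpha>) \<epsilon> y'" if "total_degree m \<le> 2" for m
        by (rule reductionD(4)[OF CC[OF that]])
      then show ?thesis using i2 degree_le_2 unfolding C_def by (simp add: eval2_sum cong: sum.cong_simp)
    qed
    moreover have "(real d * \<epsilon>) ^ t * eval_monomial \<gamma> x =
        (\<Sum>\<alpha>\<in>UNIV. eval2 (C \<alpha>) \<epsilon> y * eval_monomial (reduced_monomial \<alpha>) x)"
      if fp: "deformed_fixpoint P \<epsilon> x" for \<epsilon> x y
    proof -
      let ?E = "\<lambda>m. \<Sum>\<alpha>\<in>UNIV. eval2 (CC m \<alpha>) \<epsilon> y * eval_monomial (reduced_monomial \<alpha>) x"
      have E: "?E m = (real d * \<epsilon>) ^ s * (eval_monomial \<gamma>' x * eval_monomial m x)"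
        if "total_degree m \<le> 2" for m
        using reductionD(3)[OF CC[OF that] fp] by (simp add: eval_monomial_add)
      have "(\<Sum>\<alpha>\<in>UNIV. eval2 (C \<alpha>) \<epsilon> y * eval_monomial (reduced_monomial \<alpha>) x)
          = real d * (1 + \<epsilon>) * ?E ?i - (\<Sum>m\<in>?K. real d * coef P i m * ?E m)"
        unfolding C_def
        by (simp add: eval2_sum left_diff_distrib sum_subtractf sum_distrib_left sum_distrib_right
            sum.swap[of _ UNIV] algebra_simps sum.distrib)
      also have "(\<Sum>m\<in>?K. real d * coef P i m * ?E m) =
           (\<Sum>m\<in>?K. real d * coef P i m * ((real d * \<epsilon>) ^ s * (eval_monomial \<gamma>' x * eval_monomial m x)))"
        by (intro sum.cong refl) (use E degree_le_2 in simp)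
      also have "\<dots> = real d * (real d * \<epsilon>) ^ s * eval_monomial \<gamma>' x * eval_poly (P $ i) x"
        by (simp add: eval_poly_def sum_distrib_left mult_ac)
      also have "real d * (1 + \<epsilon>) * ?E ?i - \<dots> = real d * (real d * \<epsilon>) ^ s * eval_monomial \<gamma>' x *
           ((1 + \<epsilon>) * x $ i - eval_poly (P $ i) x)"
        unfolding E[OF i2] by (simp add: eval_monomial_single algebra_simps)
      also have "(1 + \<epsilon>) * x $ i - eval_poly (P $ i) x = \<epsilon> * x $ i ^ 3"
        using fp by (simp add: deformed_fixpoint_def)
      finally show ?thesis
        by (simp add: \<gamma> t eval_monomial_add eval_monomial_single mult_ac)
    qed
    ultimately have "reduction d t \<gamma> C" unfolding reduction_def by auto
    then show ?thesis by blast
  qed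
qed

text \<open>The exponent \<open>2 * n + 1\<close> bounds the degree of \<open>x $ k\<close> times a
  reduced monomial, and the outer exponent \<open>3 ^ n\<close> is the number of rows of the
  determinant.\<close>

lemma gap_bound:
  fixes d a b :: nat and q :: "real ^ 'n"
  assumes d: "0 < d" "\<And>i m. real d * coef P i m \<in> \<int>"
    and lfp: "is_LFP P q" and q1: "\<And>i. q $ i \<le> 1"
    and ab: "a \<le> b" "0 < b" and y: "real b * q $ k \<noteq> real a" "\<bar>real b * q $ k - real a\<bar> \<le> 1"
  shows "1 \<le> \<bar>real b * q $ k - real a\<bar> * (3 * real b * (3 * real d) ^ (2 * CARD('n) + 1)) ^ 3 ^ CARD('n)"
proof -
  let ?N = "poly_norm (poly_norm (abs :: real \<Rightarrow> real))"
  define t where "t = 2 * CARD('n) + 1"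
  have q0: "0 \<le> q $ i" and qfix: "eval_poly (P $ i) q = q $ i" for i
    using lfp by (auto simp: is_LFP_def eval_system_def vec_eq_iff)
  define \<epsilon> :: "nat \<Rightarrow> real" where "\<epsilon> j = 1 / real (Suc j)" for j
  have \<epsilon>: "0 < \<epsilon> j" for j by (simp add: \<epsilon>_def)
  have "\<epsilon> \<longlonglongrightarrow> 0" unfolding \<epsilon>_def by (rule LIMSEQ_Suc[OF lim_1_over_n])
  have "\<exists>x\<in>cbox 0 q. deformed_fixpoint P (\<epsilon> j) x" for j
  proof -
    \<comment> \<open>Below \<open>q\<close> the cube is at most \<open>q $ i ^ 3\<close>, hence at
      most \<open>q $ i\<close> because \<open>q $ i \<le> 1\<close>. So this map preserves the box
      and Brouwer's theorem yields a deformed solution.\<close>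
    let ?G = "\<lambda>x. \<chi> i. (eval_poly (P $ i) x + \<epsilon> j * x $ i ^ 3) / (1 + \<epsilon> j)"
    have "?G x \<in> cbox 0 q" if "x \<in> cbox 0 q" for x
    proof -
      have x: "\<And>i. 0 \<le> x $ i" "\<And>i. x $ i \<le> q $ i" using that by (auto simp: mem_box_cart)
      have "0 \<le> ?G x $ i" for i using eval_poly_nonneg[OF x(1), of i] x(1) \<epsilon>[of j] by simp
      moreover have "?G x $ i \<le> q $ i" for i
      proof -
        have "x $ i ^ 3 \<le> q $ i ^ 3" using x by (intro power_mono) auto
        also have "\<dots> \<le> q $ i ^ 1" using q0 q1 by (intro power_decreasing) auto
        finally have "\<epsilon> j * x $ i ^ 3 \<le> \<epsilon> j * q $ i" using \<epsilon>[of j] by (intro mult_left_mono) auto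
        moreover have "eval_poly (P $ i) x \<le> q $ i" using eval_poly_mono[OF x, of i] qfix by simp
        ultimately have "eval_poly (P $ i) x + \<epsilon> j * x $ i ^ 3 \<le> q $ i * (1 + \<epsilon> j)"
          by (simp add: algebra_simps)
        then show ?thesis using \<epsilon>[of j] by (simp add: pos_divide_le_eq)
      qed
      ultimately show ?thesis by (simp add: mem_box_cart)
    qed
    then have "?G \<in> cbox 0 q \<rightarrow> cbox 0 q" by blast
    moreover have "continuous_on (cbox 0 q) ?G"
      using \<epsilon>[of j] by (intro continuous_intros continuous_on_eval_poly) auto
    moreover have "cbox 0 q \<noteq> {}" using q0 by (simp add: interval_ne_empty_cart)
    ultimately obtain x where x: "x \<in> cbox 0 q" "?G x = x"
      using brouwer[of "cbox 0 q" ?G, OF compact_cbox convex_box(1)] by blast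
    have "(eval_poly (P $ i) x + \<epsilon> j * x $ i ^ 3) / (1 + \<epsilon> j) = x $ i" for i
      using arg_cong[OF x(2), of "\<lambda>v. v $ i"] unfolding vec_lambda_beta .
    then show ?thesis using x(1) \<epsilon>[of j]
      by (auto simp: deformed_fixpoint_def field_simps intro!: bexI[of _ x])
  qed
  then have "\<exists>X. \<forall>j. X j \<in> cbox 0 q \<and> deformed_fixpoint P (\<epsilon> j) (X j)"
    by (intro choice) blast
  then obtain X where X: "\<And>j. X j \<in> cbox 0 q" "\<And>j. deformed_fixpoint P (\<epsilon> j) (X j)" by blast
  obtain z \<rho> where z: "z \<in> cbox 0 q" and \<rho>: "strict_mono \<rho>" and lim: "(X \<circ> \<rho>) \<longlonglongrightarrow> z"
    using X(1) compact_cbox[of 0 q] unfolding compact_def by blast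
  have \<epsilon>\<rho>: "(\<epsilon> \<circ> \<rho>) \<longlonglongrightarrow> 0" using \<open>\<epsilon> \<longlonglongrightarrow> 0\<close> \<rho> by (rule LIMSEQ_subseq_LIMSEQ)
  \<comment> \<open>The \<epsilon> terms vanish in the limit, so \<open>z\<close> is a fixed point
    of the original system below \<open>q\<close>, and leastness identifies it with
    \<open>q\<close>.\<close>
  have "eval_poly (P $ i) z = z $ i" for i
  proof -
    have Xi: "(\<lambda>j. (X \<circ> \<rho>) j $ i) \<longlonglongrightarrow> z $ i" by (intro tendsto_vec_nth lim)
    have "(\<lambda>j. eval_poly (P $ i) ((X \<circ> \<rho>) j) + (\<epsilon> \<circ> \<rho>) j * (X \<circ> \<rho>) j $ i ^ 3)
          \<longlonglongrightarrow> eval_poly (P $ i) z + 0 * z $ i ^ 3"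
      by (intro tendsto_add tendsto_mult tendsto_power Xi
          continuous_on_tendsto_compose[OF continuous_on_eval_poly[of UNIV]] lim)
        (use \<epsilon>\<rho> in \<open>simp_all add: o_def\<close>)
    moreover have "(\<lambda>j. (1 + (\<epsilon> \<circ> \<rho>) j) * (X \<circ> \<rho>) j $ i) \<longlonglongrightarrow> (1 + 0) * z $ i"
      by (intro tendsto_mult tendsto_add tendsto_const Xi) (use \<epsilon>\<rho> in \<open>simp add: o_def\<close>)
    moreover have "(1 + (\<epsilon> \<circ> \<rho>) j) * (X \<circ> \<rho>) j $ i
        = eval_poly (P $ i) ((X \<circ> \<rho>) j) + (\<epsilon> \<circ> \<rho>) j * (X \<circ> \<rho>) j $ i ^ 3" for j
      using X(2)[of "\<rho> j"] by (simp add: deformed_fixpoint_def)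
    ultimately show ?thesis using LIMSEQ_unique by fastforce
  qed
  then have "q $ i \<le> z $ i" for i
    using lfp z by (auto simp: is_LFP_def eval_system_def mem_box_cart vec_eq_iff)
  then have "z = q" using z by (auto simp: mem_box_cart vec_eq_iff intro: order_antisym)

  have "\<exists>C. reduction d t (reduced_monomial \<alpha> + Poly_Mapping.single k 1) C" for \<alpha>
    using total_degree_reduced_monomial[of \<alpha>]
    by (intro reduction_exists d) (simp add: total_degree_add total_degree_single t_def)
  then obtain C where C: "\<And>\<alpha>. reduction d t (reduced_monomial \<alpha> + Poly_Mapping.single k 1) (C \<alpha>)" by metis
  \<comment> \<open>The inner indeterminate stands for \<open>b * x $ k - a\<close>. The matrix is
    \<open>(d * \<epsilon>) ^ t * (a + y)\<close> times the identity, minus \<open>b\<close> times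
    the scaled multiplication by \<open>x $ k\<close>. At a deformed solution it annihilates the
    vector of reduced monomials.\<close>
  define A :: "real poly poly ^ ('n \<Rightarrow> bool option) ^ ('n \<Rightarrow> bool option)" where
    "A = (\<chi> \<alpha> \<beta>. (if \<alpha> = \<beta> then monom (smult (real d ^ t) [:real a, 1:]) t else 0) - [:[:real b:]:] * C \<alpha> \<beta>)"
  have evalA: "eval2 (A $ \<alpha> $ \<beta>) e v =
      (if \<alpha> = \<beta> then (real a + v) * (real d * e) ^ t else 0) - real b * eval2 (C \<alpha> \<beta>) e v" for \<alpha> \<beta> e v
    by (simp add: A_def power_mult_distrib algebra_simps)
  have int: "det A \<in> polys_over (polys_over \<int>)"
  proof (rule int_bipolys.det)
    fix \<alpha> \<beta>
    show "A $ \<alpha> $ \<beta> \<in> polys_over (polys_over \<int>)"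
    proof -
      have "[:[:real b:]:] * C \<alpha> \<beta> \<in> polys_over (polys_over \<int>)"
        by (intro int_bipolys.mult reductionD(1)[OF C])
          (simp add: int_polys.pCons_polys_over ints.pCons_polys_over int_polys.zero_polys_over ints.zero_polys_over)
      moreover have "monom (smult (real d ^ t) [:real a, 1:]) t \<in> polys_over (polys_over \<int>)"
        by (intro int_polys.monom_polys_over) (simp add: ints.pCons_polys_over ints.zero_polys_over)
      ultimately show ?thesis
        unfolding A_def by (auto simp del: mult_pCons_left intro: int_bipolys.diff int_bipolys.zero int_bipolys.minus)
    qed
  qed
  have root: "eval2 (det A) (\<epsilon> j) (real b * X j $ k - real a) = 0" for j
  proof -
    let ?v = "real b * X j $ k - real a"
    let ?M = "\<chi> \<alpha> \<beta>. eval2 (A $ \<alpha> $ \<beta>) (\<epsilon> j) ?v" and ?w = "\<chi> \<alpha>. eval_monomial (reduced_monomial \<alpha>) (X j)"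
    have "(?M *v ?w) $ \<alpha> = 0" for \<alpha>
    proof -
      have "(?M *v ?w) $ \<alpha> = (real a + ?v) * (real d * \<epsilon> j) ^ t * eval_monomial (reduced_monomial \<alpha>) (X j)
           - real b * (\<Sum>\<beta>\<in>UNIV. eval2 (C \<alpha> \<beta>) (\<epsilon> j) ?v * eval_monomial (reduced_monomial \<beta>) (X j))"
        by (simp add: matrix_vector_mult_def evalA left_diff_distrib sum_subtractf sum_distrib_left
            if_distrib[of "\<lambda>x. x * _"] mult.assoc cong: if_cong)
      also have "\<dots> = 0"
        unfolding reductionD(3)[OF C X(2), symmetric]
        by (simp add: eval_monomial_add eval_monomial_single)
      finally show ?thesis .
    qed
    then have "?M *v ?w = 0" by (simp add: vec_eq_iff)
    moreover have "?w \<noteq> 0"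
    proof -
      obtain \<alpha> :: "'n \<Rightarrow> bool option" where "reduced_monomial \<alpha> = 0"
        using reduced_monomial_surj[of 0] by auto
      then have "?w $ \<alpha> = 1" by (simp add: eval_monomial_0)
      then show ?thesis by (metis zero_index zero_neq_one)
    qed
    ultimately have "\<not> invertible ?M"
      by (metis invertible_left_inverse matrix_left_invertible_ker)
    then show ?thesis by (simp add: eval2_det invertible_det_nz)
  qed
  have nonzero: "det A \<noteq> 0"
  proof
    assume "det A = 0"
    define c where "c \<alpha> \<beta> = eval2 (C \<alpha> \<beta>) 1 0" for \<alpha> \<beta>
    have c: "eval2 (C \<alpha> \<beta>) 1 v = c \<alpha> \<beta>" for \<alpha> \<beta> v
      unfolding c_def by (rule reductionD(4)[OF C])
    define K where "K = (\<Sum>\<alpha>\<in>UNIV. \<Sum>\<beta>\<in>UNIV. \<bar>c \<alpha> \<beta>\<bar>)"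
    have K: "(\<Sum>\<beta>\<in>UNIV. \<bar>c \<alpha> \<beta>\<bar>) \<le> K" for \<alpha>
      unfolding K_def by (rule member_le_sum[of \<alpha> UNIV "\<lambda>\<alpha>. \<Sum>\<beta>\<in>UNIV. \<bar>c \<alpha> \<beta>\<bar>"]) (auto intro: sum_nonneg)
    then have "0 \<le> K" by (meson abs_ge_zero order_trans sum_nonneg)
    \<comment> \<open>At \<epsilon> = 1 the entries \<open>c\<close> are constants with absolute row
      sums at most \<open>K\<close>. This \<open>v\<close> makes the scalar part exceed
      \<open>b * K\<close>, and a kernel vector is refuted at its largest coordinate.\<close>
    define v where "v = real b * K + 1"
    let ?M = "\<chi> \<alpha> \<beta>. eval2 (A $ \<alpha> $ \<beta>) 1 v"
    have "det ?M = 0" using eval2_det[of A 1 v] \<open>det A = 0\<close> by simp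
    then have "\<not> invertible ?M" by (simp add: invertible_det_nz)
    then obtain w where w: "?M *v w = 0" "w \<noteq> 0"
      by (metis invertible_left_inverse matrix_left_invertible_ker)
    define \<mu> where "\<mu> = Max (range (\<lambda>\<alpha>. \<bar>w $ \<alpha>\<bar>))"
    have \<mu>_ge: "\<bar>w $ \<alpha>\<bar> \<le> \<mu>" for \<alpha> by (auto simp: \<mu>_def)
    have "\<mu> \<in> range (\<lambda>\<alpha>. \<bar>w $ \<alpha>\<bar>)" unfolding \<mu>_def by (rule Max_in) auto
    then obtain \<alpha> where \<alpha>: "\<bar>w $ \<alpha>\<bar> = \<mu>" by auto
    obtain \<beta> where "w $ \<beta> \<noteq> 0" using w(2) by (metis vec_eq_iff zero_index)
    then have "0 < \<mu>" using \<mu>_ge[of \<beta>] by linarith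
    have "(?M *v w) $ \<alpha> = (real a + v) * real d ^ t * w $ \<alpha> - real b * (\<Sum>\<beta>\<in>UNIV. c \<alpha> \<beta> * w $ \<beta>)"
      by (simp add: matrix_vector_mult_def evalA c left_diff_distrib sum_subtractf sum_distrib_left
          if_distrib[of "\<lambda>x. x * _"] mult.assoc cong: if_cong)
    then have "(real a + v) * real d ^ t * w $ \<alpha> = real b * (\<Sum>\<beta>\<in>UNIV. c \<alpha> \<beta> * w $ \<beta>)"
      using w(1) by simp
    then have "\<bar>(real a + v) * real d ^ t * w $ \<alpha>\<bar> = \<bar>real b * (\<Sum>\<beta>\<in>UNIV. c \<alpha> \<beta> * w $ \<beta>)\<bar>" by simp
    then have "(real a + v) * real d ^ t * \<mu> = real b * \<bar>\<Sum>\<beta>\<in>UNIV. c \<alpha> \<beta> * w $ \<beta>\<bar>"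
      using \<open>0 \<le> K\<close> \<alpha> by (simp add: abs_mult v_def)
    also have "\<bar>\<Sum>\<beta>\<in>UNIV. c \<alpha> \<beta> * w $ \<beta>\<bar> \<le> (\<Sum>\<beta>\<in>UNIV. \<bar>c \<alpha> \<beta>\<bar> * \<mu>)"
      by (intro order_trans[OF sum_abs] sum_mono) (auto simp: abs_mult intro: mult_left_mono \<mu>_ge)
    also have "\<dots> = (\<Sum>\<beta>\<in>UNIV. \<bar>c \<alpha> \<beta>\<bar>) * \<mu>" by (simp add: sum_distrib_right)
    also have "\<dots> \<le> K * \<mu>" using K \<open>0 < \<mu>\<close> by (intro mult_right_mono) auto
    finally have "(real a + v) * real d ^ t * \<mu> \<le> (real b * K) * \<mu>"
      by (simp add: mult_left_mono mult.assoc)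
    then have "(real a + v) * real d ^ t \<le> real b * K" using \<open>0 < \<mu>\<close> by simp
    moreover have "v * 1 \<le> (real a + v) * real d ^ t"
      using d(1) \<open>0 \<le> K\<close> by (intro mult_mono one_le_power) (auto simp: v_def)
    ultimately show False by (simp add: v_def)
  qed
  have norm: "?N (det A) \<le> (3 * real b * (3 * real d) ^ t) ^ 3 ^ CARD('n)"
  proof -
    have "(\<Sum>\<beta>\<in>UNIV. ?N (A $ \<alpha> $ \<beta>)) \<le> 3 * real b * (3 * real d) ^ t" for \<alpha>
    proof -
      have "?N (A $ \<alpha> $ \<beta>) \<le> (if \<beta> = \<alpha> then real d ^ t * (1 + real a) else 0) + real b * ?N (C \<alpha> \<beta>)" for \<beta>
      proof -
        have "poly_norm abs (smult (real d ^ t) [:real a, 1:]) \<le> real d ^ t * (1 + real a)"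
          using real_abs.poly_norm_smult[of "real d ^ t" "[:real a, 1:]"]
          by (simp add: real_abs.poly_norm_pCons real_abs.poly_norm_0 add.commute)
        moreover have "?N ([:[:real b:]:] * C \<alpha> \<beta>) \<le> real b * ?N (C \<alpha> \<beta>)"
          using bipoly_abs.mult[of "[:[:real b:]:]" "C \<alpha> \<beta>"]
          by (simp add: poly_abs.poly_norm_pCons poly_abs.poly_norm_0 real_abs.poly_norm_pCons real_abs.poly_norm_0)
        ultimately show ?thesis
          using bipoly_abs.diff[of "if \<alpha> = \<beta> then monom (smult (real d ^ t) [:real a, 1:]) t else 0"
              "[:[:real b:]:] * C \<alpha> \<beta>"]
          by (auto simp: A_def poly_abs.poly_norm_monom poly_abs.poly_norm_0 split: if_splits)
      qed
      then have "(\<Sum>\<beta>\<in>UNIV. ?N (A $ \<alpha> $ \<beta>)) \<le>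
          (\<Sum>\<beta>\<in>UNIV. (if \<beta> = \<alpha> then real d ^ t * (1 + real a) else 0) + real b * ?N (C \<alpha> \<beta>))"
        by (intro sum_mono)
      also have "\<dots> = real d ^ t * (1 + real a) + real b * (\<Sum>\<beta>\<in>UNIV. ?N (C \<alpha> \<beta>))"
        by (simp add: sum.distrib sum_distrib_left)
      \<comment> \<open>From \<open>a \<le> b\<close> and \<open>0 < b\<close> follows
        \<open>1 + a \<le> 2 * b\<close>.\<close>
      also have "\<dots> \<le> (3 * real d) ^ t * (2 * real b) + real b * (3 * real d) ^ t"
        using ab by (intro add_mono mult_mono mult_left_mono[OF reductionD(2)[OF C]] power_mono) auto
      also have "\<dots> = 3 * real b * (3 * real d) ^ t" by simp
      finally show ?thesis .
    qed
    then have "(\<Prod>\<alpha>\<in>UNIV. \<Sum>\<beta>\<in>UNIV. ?N (A $ \<alpha> $ \<beta>)) \<le> (\<Prod>\<alpha>\<in>(UNIV :: ('n \<Rightarrow> bool option) set). 3 * real b * (3 * real d) ^ t)"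
      by (intro prod_mono) (auto intro: sum_nonneg poly_abs.poly_norm_nonneg)
    then show ?thesis using bipoly_abs.det[of A] by (simp add: card_fun)
  qed
  have "(\<lambda>j. real b * (X \<circ> \<rho>) j $ k - real a) \<longlonglongrightarrow> real b * q $ k - real a"
    using lim unfolding \<open>z = q\<close> by (intro tendsto_intros)
  then have "1 \<le> \<bar>real b * q $ k - real a\<bar> * ?N (det A)"
    using limit_root_bound[OF nonzero int, of "\<epsilon> \<circ> \<rho>" "\<lambda>j. real b * (X \<circ> \<rho>) j $ k - real a"] root \<epsilon> \<epsilon>\<rho> y
    by simp
  also have "\<dots> \<le> \<bar>real b * q $ k - real a\<bar> * (3 * real b * (3 * real d) ^ t) ^ 3 ^ CARD('n)"
    by (intro mult_left_mono norm) auto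
  finally show ?thesis unfolding t_def .
qed

end

section \<open>Newton's method below the least fixed point\<close>

lemma matrix_mult_matrix_inv: "invertible A \<Longrightarrow> A ** matrix_inv A = mat 1"
  unfolding invertible_def matrix_inv_def by (rule someI2_ex) auto

locale quadratic_linear_system =
  fixes Q :: "'n::finite set" and l r :: "'n \<Rightarrow> 'n" and p :: "'n \<Rightarrow> 'n \<Rightarrow> real" and c :: "'n \<Rightarrow> real"
  assumes p_nonneg: "0 \<le> p i j" and c_nonneg: "0 \<le> c i"
    and row_sum: "(\<Sum>j\<in>UNIV. p i j) + c i \<le> 1"
begin

definition F :: "real ^ 'n \<Rightarrow> real ^ 'n" where
  "F x = (\<chi> i. if i \<in> Q then x $ l i * x $ r i else (\<Sum>j\<in>UNIV. p i j * x $ j) + c i)"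

text \<open>For \<open>l i = r i\<close> both summands fall into one column and add up to the
  derivative of a square.\<close>

definition B :: "real ^ 'n \<Rightarrow> real ^ 'n ^ 'n" where
  "B x = (\<chi> i j. if i \<in> Q then (if j = l i then x $ r i else 0) + (if j = r i then x $ l i else 0)
                 else p i j)"

lemma B_mult:
  "(B x *v h) $ i = (if i \<in> Q then x $ r i * h $ l i + x $ l i * h $ r i
                     else (\<Sum>j\<in>UNIV. p i j * h $ j))"
proof (cases "i \<in> Q")
  case True
  have "(B x *v h) $ i = (\<Sum>j\<in>UNIV. (if j = l i then x $ r i * h $ j else 0)
                                     + (if j = r i then x $ l i * h $ j else 0))"
    unfolding matrix_vector_mult_def B_def using True
    by (auto intro!: sum.cong simp: distrib_right)
  then show ?thesis using True by (simp add: sum.distrib)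
next
  case False
  then show ?thesis by (simp add: matrix_vector_mult_def B_def)
qed

lemma I_minus_B_mult: "((mat 1 - B x) *v h) $ i = h $ i - (B x *v h) $ i"
  by (simp add: matrix_vector_mult_diff_rdistrib)

text \<open>Quadratic rows have degree two, so the second-order expansion is exact; the product of
  increments is the only source of Newton error.\<close>

lemma F_add:
  "F (x + h) $ i = F x $ i + (B x *v h) $ i + (if i \<in> Q then h $ l i * h $ r i else 0)"
  by (simp add: B_mult F_def algebra_simps sum.distrib)

lemma F_mono:
  assumes "\<And>i. 0 \<le> x $ i" "\<And>i. x $ i \<le> y $ i"
  shows "F x $ i \<le> F y $ i"
  using assms order.trans[OF assms]
  by (auto simp: F_def intro!: mult_mono sum_mono mult_left_mono p_nonneg)

lemma F_nonneg: "(\<And>i. 0 \<le> x $ i) \<Longrightarrow> 0 \<le> F x $ i"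
  by (auto simp: F_def intro!: add_nonneg_nonneg sum_nonneg mult_nonneg_nonneg p_nonneg c_nonneg)

lemma continuous_on_F: "continuous_on S F"
proof -
  have "continuous_on S (\<lambda>x. \<chi> i. if i \<in> Q then x $ l i * x $ r i
                                  else (\<Sum>j\<in>UNIV. p i j * x $ j) + c i)"
  proof (intro continuous_on_vec_lambda)
    fix i show "continuous_on S (\<lambda>x. if i \<in> Q then x $ l i * x $ r i
                                  else (\<Sum>j\<in>UNIV. p i j * x $ j) + c i)"
      by (cases "i \<in> Q") (auto intro!: continuous_intros)
  qed
  then show ?thesis unfolding F_def .
qed

lemma F_has_derivative: "(F has_derivative (\<lambda>h. B x *v h)) (at x)"
proof -
  have "((\<lambda>y. \<Sum>i\<in>UNIV. axis i (F y $ i)) has_derivative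
         (\<lambda>h. \<Sum>i\<in>UNIV. axis i ((B x *v h) $ i))) (at x)"
  proof (rule has_derivative_sum)
    fix i
    have "((\<lambda>y. F y $ i) has_derivative (\<lambda>h. (B x *v h) $ i)) (at x)"
      by (cases "i \<in> Q") (auto simp: F_def B_mult mult.commute
          intro!: derivative_eq_intros bounded_linear_imp_has_derivative[OF bounded_linear_vec_nth])
    moreover have "bounded_linear (axis i :: real \<Rightarrow> real ^ 'n)"
      by (auto intro!: linear_conv_bounded_linear[THEN iffD1] linearI simp: axis_def vec_eq_iff)
    ultimately show "((\<lambda>y. axis i (F y $ i)) has_derivative (\<lambda>h. axis i ((B x *v h) $ i))) (at x)"
      using bounded_linear.has_derivative by blast
  qed
  moreover have "(\<Sum>i\<in>UNIV. axis i (v $ i)) = v" for v :: "real ^ 'n"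
    by (simp add: vec_eq_iff axis_def if_distrib cong: if_cong)
  ultimately show ?thesis by simp
qed

lemma jacobian_F: "jacobian F (at x) = B x"
proof -
  have "frechet_derivative F (at x) = (\<lambda>h. B x *v h)"
    using frechet_derivative_at[OF F_has_derivative] by simp
  then show ?thesis by (simp add: jacobian_def matrix_of_matrix_vector_mul)
qed

end

section \<open>Least fixed point and nonnegativity of the inverse of I - B\<close>

locale positive_least_fixpoint = quadratic_linear_system Q l r p c
  for Q :: "'n::finite set" and l r p c +
  fixes q :: "real ^ 'n"
  assumes q_fix: "F q = q" and q_pos: "0 < q $ i" and q_less_1: "q $ i < 1"
    and q_least: "(\<And>i. 0 \<le> y $ i) \<Longrightarrow> F y = y \<Longrightarrow> q $ i \<le> y $ i"
begin

text \<open>Monotonicity makes \<open>F\<close> preserve the box below \<open>y\<close>, and the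
  Brouwer fixed point found there lies above \<open>q\<close>.\<close>

lemma least_postfixpoint:
  assumes y: "\<And>i. 0 \<le> y $ i" "\<And>i. F y $ i \<le> y $ i"
  shows "q $ i \<le> y $ i"
proof -
  have "F z \<in> cbox 0 y" if "z \<in> cbox 0 y" for z
  proof -
    have z: "\<And>i. 0 \<le> z $ i" "\<And>i. z $ i \<le> y $ i" using that by (auto simp: mem_box_cart)
    then have "F z $ i \<le> y $ i" for i using F_mono[OF z, of i] y(2)[of i] by linarith
    then show ?thesis using F_nonneg[OF z(1)] by (simp add: mem_box_cart)
  qed
  then have "F \<in> cbox 0 y \<rightarrow> cbox 0 y" by blast
  moreover have "y \<in> cbox 0 y" using y by (simp add: mem_box_cart)
  ultimately obtain z where "z \<in> cbox 0 y" and Fz: "F z = z"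
    using brouwer[of "cbox 0 y" F] continuous_on_F[of "cbox 0 y"]
    by (metis compact_cbox convex_box(1) empty_iff)
  then have z: "\<And>i. 0 \<le> z $ i" "\<And>i. z $ i \<le> y $ i" "F z = z"
    using Fz by (simp_all add: mem_box_cart)
  then show ?thesis using q_least[of z i] by (meson order_trans)
qed

text \<open>Setting such coordinates of \<open>q\<close> to zero would leave a post-fixed point, so
  leastness would contradict positivity of \<open>q\<close>.\<close>

lemma no_linear_trap:
  assumes "S \<noteq> {}" "S \<inter> Q = {}" "\<And>i. i \<in> S \<Longrightarrow> c i = 0"
    and "\<And>i j. i \<in> S \<Longrightarrow> j \<notin> S \<Longrightarrow> p i j = 0"
  shows False
proof -
  let ?y = "\<chi> i. if i \<in> S then 0 else q $ i"
  have q0: "0 \<le> q $ i" for i using q_pos less_imp_le by blast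
  have "F ?y $ i \<le> ?y $ i" for i
  proof (cases "i \<in> S")
    case True
    then have "p i j * ?y $ j = 0" for j using assms(4) by simp
    then have "(\<Sum>j\<in>UNIV. p i j * ?y $ j) = 0" by (simp only: sum.neutral_const)
    then show ?thesis using True assms by (auto simp: F_def disjoint_iff)
  next
    case False
    have "F ?y $ i \<le> F q $ i" by (rule F_mono) (use q0 in auto)
    then show ?thesis using False q_fix by simp
  qed
  then have le: "q $ i \<le> ?y $ i" for i
    by (rule least_postfixpoint[rotated]) (use q0 in simp)
  obtain i where "i \<in> S" using assms by blast
  then have "q $ i \<le> 0" using le[of i] by simp
  then show False using q_pos[of i] by simp
qed

definition u :: "real ^ 'n" where "u = (\<chi> i. 1 - q $ i)"

lemma u_pos: "0 < u $ i" and u_less_1: "u $ i < 1"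
  using q_pos q_less_1 by (auto simp: u_def)

lemma u_linear: "i \<notin> Q \<Longrightarrow> u $ i = (1 - (\<Sum>j\<in>UNIV. p i j) - c i) + (\<Sum>j\<in>UNIV. p i j * u $ j)"
  using arg_cong[OF q_fix, of "\<lambda>v. v $ i"]
  by (simp add: F_def u_def algebra_simps sum_subtractf)

lemma u_quadratic: "i \<in> Q \<Longrightarrow> u $ i = u $ l i + u $ r i - u $ l i * u $ r i"
  using arg_cong[OF q_fix, of "\<lambda>v. v $ i"]
  by (simp add: F_def u_def algebra_simps)

text \<open>For \<open>e \<ge> 0\<close> the right side is positive in quadratic rows and equals the
  nonnegative slack of the coefficient sum in linear ones. Both nonnegativity of the inverse and the
  error contraction rest on this.\<close>

lemma I_minus_B_u:
  "((mat 1 - B (q - e)) *v u) $ i =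
     (if i \<in> Q then u $ l i * u $ r i + e $ l i * u $ r i + e $ r i * u $ l i
      else 1 - (\<Sum>j\<in>UNIV. p i j) - c i)"
proof (cases "i \<in> Q")
  case True
  have "u $ j = 1 - q $ j" for j by (simp add: u_def)
  then have q: "q $ j = 1 - u $ j" for j by simp
  show ?thesis using True by (simp add: q I_minus_B_mult B_mult u_quadratic[OF True] algebra_simps)
next
  case False
  then show ?thesis by (simp add: I_minus_B_mult B_mult u_linear[OF False])
qed

text \<open>
  The coordinates where \<open>z / u\<close> is most negative depend linearly, and only, on each other; those of
  them with the largest \<open>u\<close> would form a trap.
\<close>

lemma I_minus_B_inverse_nonneg:
  assumes x: "\<And>i. 0 \<le> x $ i" "\<And>i. x $ i \<le> q $ i"
    and z: "\<And>i. 0 \<le> ((mat 1 - B x) *v z) $ i"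
  shows "0 \<le> z $ i"
proof (rule ccontr)
  assume neg: "\<not> 0 \<le> z $ i"
  \<comment> \<open>The least factor for which \<open>z + \<kappa> *\<^sub>R u\<close> is
    nonnegative; \<open>S\<close> will collect the coordinates where that sum is zero.\<close>
  define \<kappa> where "\<kappa> = Max (range (\<lambda>j. - z $ j / u $ j))"
  have le: "- z $ j / u $ j \<le> \<kappa>" for j by (auto simp: \<kappa>_def)
  have "0 < - z $ i / u $ i" using neg u_pos[of i] by (simp add: divide_simps)
  then have \<kappa>: "0 < \<kappa>" using le[of i] by linarith
  define y where "y = z + \<kappa> *\<^sub>R u"
  have y0: "0 \<le> y $ j" for j
    using le[of j] u_pos[of j] by (simp add: y_def field_simps)
  define S where "S = {j. y $ j = 0}"
  have "\<kappa> \<in> range (\<lambda>j. - z $ j / u $ j)" unfolding \<kappa>_def by (rule Max_in) auto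
  then obtain j0 where "- z $ j0 / u $ j0 = \<kappa>" by auto
  then have "j0 \<in> S" using u_pos[of j0] by (auto simp: S_def y_def field_simps)
  \<comment> \<open>On \<open>S\<close> the vector \<open>y\<close> vanishes, so
    \<open>(I - B x) y\<close> reduces there to minus \<open>B x *v y\<close>, while
    \<open>(I - B x) z\<close> is nonnegative by assumption.\<close>
  have By: "(B x *v y) $ j \<le> - \<kappa> * ((mat 1 - B x) *v u) $ j" if "j \<in> S" for j
  proof -
    have "((mat 1 - B x) *v y) $ j = ((mat 1 - B x) *v z) $ j + \<kappa> * ((mat 1 - B x) *v u) $ j"
      by (simp add: y_def matrix_vector_right_distrib matrix_vector_mult_scaleR)
    moreover have "((mat 1 - B x) *v y) $ j = - (B x *v y) $ j"
      using that by (simp add: I_minus_B_mult S_def)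
    ultimately show ?thesis using z[of j] by simp
  qed
  define e where "e = q - x"
  have e: "x = q - e" "\<And>i. 0 \<le> e $ i" using x by (auto simp: e_def)
  have SQ: "j \<notin> Q" if "j \<in> S" for j
  proof
    assume jQ: "j \<in> Q"
    have "0 \<le> (B x *v y) $ j" using jQ x y0 by (auto simp: B_mult)
    moreover have "0 < ((mat 1 - B x) *v u) $ j"
    proof -
      have "0 < u $ l j * u $ r j" using u_pos by simp
      moreover have "0 \<le> e $ l j * u $ r j" "0 \<le> e $ r j * u $ l j"
        by (intro mult_nonneg_nonneg e(2) order.strict_implies_order[OF u_pos])+
      ultimately show ?thesis using jQ unfolding e(1) I_minus_B_u by simp
    qed
    ultimately show False using By[OF that] \<kappa> by (smt (verit) mult_pos_pos mult_minus_left)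
  qed
  \<comment> \<open>The weighted sum of \<open>y\<close> is nonnegative, yet at most minus \<kappa>
    times a nonnegative slack; both vanish, so no weight meets a positive
    \<open>y $ k\<close>.\<close>
  have lin: "1 - (\<Sum>k\<in>UNIV. p j k) - c j = 0 \<and> (\<forall>k. k \<notin> S \<longrightarrow> p j k = 0)" if "j \<in> S" for j
  proof -
    have 1: "(\<Sum>k\<in>UNIV. p j k * y $ k) \<le> - \<kappa> * (1 - (\<Sum>k\<in>UNIV. p j k) - c j)"
      using By[OF that] SQ[OF that] unfolding e(1) I_minus_B_u by (simp add: B_mult)
    have 2: "0 \<le> (\<Sum>k\<in>UNIV. p j k * y $ k)" by (intro sum_nonneg mult_nonneg_nonneg p_nonneg y0)
    have 3: "0 \<le> \<kappa> * (1 - (\<Sum>k\<in>UNIV. p j k) - c j)" using \<kappa> row_sum[of j] by simp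
    have "(\<Sum>k\<in>UNIV. p j k * y $ k) = 0" using 1 2 3 by simp
    then have "\<forall>k. p j k * y $ k = 0"
      using sum_nonneg_eq_0_iff[of UNIV "\<lambda>k. p j k * y $ k"] p_nonneg y0 by simp
    moreover have "1 - (\<Sum>k\<in>UNIV. p j k) - c j = 0" proof -
      have "\<kappa> * (1 - (\<Sum>k\<in>UNIV. p j k) - c j) = 0" using 1 2 3 by linarith
      then show ?thesis using \<kappa> by simp
    qed
    ultimately show ?thesis by (auto simp: S_def)
  qed
  define \<mu> where "\<mu> = Max ((\<lambda>j. u $ j) ` S)"
  have \<mu>_ge: "u $ j \<le> \<mu>" if "j \<in> S" for j using that by (auto simp: \<mu>_def)
  have "\<mu> \<in> (\<lambda>j. u $ j) ` S" unfolding \<mu>_def by (rule Max_in) (use \<open>j0 \<in> S\<close> in auto)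
  define T where "T = {j \<in> S. u $ j = \<mu>}"
  have "T \<noteq> {}" using \<open>\<mu> \<in> _\<close> by (auto simp: T_def)
  have "0 < \<mu>" using \<open>\<mu> \<in> _\<close> u_pos by auto
  \<comment> \<open>Maximum principle: \<mu> is a combination of values \<open>u $ k\<close> with
    weights summing to \<open>1 - c j\<close>. All values carrying weight are at most \<mu>, so
    \<open>c j = 0\<close> and the weights sit on \<open>T\<close>.\<close>
  have T: "c j = 0 \<and> (\<forall>k. k \<notin> T \<longrightarrow> p j k = 0)" if "j \<in> T" for j
  proof -
    have jS: "j \<in> S" "u $ j = \<mu>" using that by (auto simp: T_def)
    have nn: "0 \<le> p j k * (\<mu> - u $ k)" for k
      using lin[OF jS(1)] \<mu>_ge[of k] p_nonneg[of j k] by (cases "k \<in> S") auto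
    have "\<mu> = (\<Sum>k\<in>UNIV. p j k * u $ k)" using u_linear[OF SQ[OF jS(1)]] lin[OF jS(1)] jS by simp
    moreover have "(\<Sum>k\<in>UNIV. p j k * (\<mu> - u $ k)) = (\<Sum>k\<in>UNIV. p j k) * \<mu> - (\<Sum>k\<in>UNIV. p j k * u $ k)"
      by (simp add: algebra_simps sum_subtractf sum_distrib_left sum_distrib_right)
    moreover have "(\<Sum>k\<in>UNIV. p j k) = 1 - c j" using lin[OF jS(1)] by simp
    ultimately have eq: "(\<Sum>k\<in>UNIV. p j k * (\<mu> - u $ k)) = - c j * \<mu>" by (simp add: algebra_simps)
    have "0 \<le> (\<Sum>k\<in>UNIV. p j k * (\<mu> - u $ k))" by (intro sum_nonneg nn)
    then have "c j = 0" using eq \<open>0 < \<mu>\<close> c_nonneg[of j] by (simp add: mult_le_0_iff)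
    moreover from this have "\<forall>k. p j k * (\<mu> - u $ k) = 0"
      using eq sum_nonneg_eq_0_iff[of UNIV "\<lambda>k. p j k * (\<mu> - u $ k)"] nn by simp
    ultimately show ?thesis using lin[OF jS(1)] by (auto simp: T_def)
  qed
  show False by (rule no_linear_trap[of T]) (use \<open>T \<noteq> {}\<close> T SQ in \<open>auto simp: T_def\<close>)
qed

text \<open>A kernel vector and its negative are both nonnegative by the preceding lemma.\<close>

lemma invertible_I_minus_B:
  assumes x: "\<And>i. 0 \<le> x $ i" "\<And>i. x $ i \<le> q $ i"
  shows "invertible (mat 1 - B x)"
proof -
  have "z = 0" if "(mat 1 - B x) *v z = 0" for z
  proof -
    have "0 \<le> z $ i" for i using I_minus_B_inverse_nonneg[OF x, of z i] that by simp
    moreover have "0 \<le> (- z) $ i" for i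
      using I_minus_B_inverse_nonneg[OF x, of "- z" i] that
      using matrix_vector_mult_diff_distrib[of "mat 1 - B x" 0 z] by simp
    ultimately show ?thesis by (simp add: vec_eq_iff order_antisym)
  qed
  then show ?thesis by (metis invertible_left_inverse matrix_left_invertible_ker)
qed

section \<open>Newton steps and their error\<close>

definition newton :: "real ^ 'n \<Rightarrow> real ^ 'n" where
  "newton x = x + matrix_inv (mat 1 - B x) *v (F x - x)"

lemma newton_equation:
  assumes x: "\<And>i. 0 \<le> x $ i" "\<And>i. x $ i \<le> q $ i"
  shows "(mat 1 - B x) *v (newton x - x) = F x - x"
proof -
  have "(mat 1 - B x) *v (newton x - x) = ((mat 1 - B x) ** matrix_inv (mat 1 - B x)) *v (F x - x)"
    by (simp add: newton_def matrix_vector_mul_assoc)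
  then show ?thesis using matrix_mult_matrix_inv[OF invertible_I_minus_B[OF x]] by simp
qed

lemma newton_error_equation:
  assumes x: "\<And>i. 0 \<le> x $ i" "\<And>i. x $ i \<le> q $ i"
  shows "((mat 1 - B x) *v (q - newton x)) $ i = (if i \<in> Q then (q - x) $ l i * (q - x) $ r i else 0)"
proof -
  have "(mat 1 - B x) *v (q - newton x) = (mat 1 - B x) *v (q - x) - (F x - x)"
    by (simp add: newton_equation[OF x, symmetric] matrix_vector_mult_diff_distrib)
  then show ?thesis
    using F_add[of x "q - x" i] q_fix by (simp add: I_minus_B_mult)
qed

text \<open>The condition \<open>x \<le> F x\<close> makes the increment nonnegative. It is
  reproduced because the residual at the new point is exactly the product of increments left by the
  expansion.\<close>

lemma newton_invariant:
  assumes x: "\<And>i. 0 \<le> x $ i" "\<And>i. x $ i \<le> q $ i" and pre: "\<And>i. x $ i \<le> F x $ i"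
  shows "0 \<le> newton x $ i" "newton x $ i \<le> q $ i" "newton x $ i \<le> F (newton x) $ i"
proof -
  have "0 \<le> (newton x - x) $ j" for j
    by (rule I_minus_B_inverse_nonneg[OF x]) (use pre newton_equation[OF x] in auto)
  then have \<Delta>: "0 \<le> newton x $ j - x $ j" for j by simp
  show "0 \<le> newton x $ i" using \<Delta>[of i] x(1)[of i] by linarith
  have "0 \<le> (q - newton x) $ i"
    by (rule I_minus_B_inverse_nonneg[OF x]) (use x in \<open>auto simp: newton_error_equation[OF x]\<close>)
  then show "newton x $ i \<le> q $ i" by simp
  have "F (newton x) $ i - newton x $ i = (if i \<in> Q then (newton x - x) $ l i * (newton x - x) $ r i else 0)"
    using F_add[of x "newton x - x" i] arg_cong[OF newton_equation[OF x], of "\<lambda>v. v $ i"]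
    by (simp add: I_minus_B_mult)
  then show "newton x $ i \<le> F (newton x) $ i"
    using \<Delta> by (smt (verit) mult_nonneg_nonneg vector_minus_component)
qed

lemma newton_contraction:
  assumes x: "\<And>i. 0 \<le> x $ i" "\<And>i. x $ i \<le> q $ i" and t: "0 \<le> t" and e: "\<And>i. t * (q - x) $ i \<le> u $ i"
  shows "((1 + t)\<^sup>2 - 1) * (q - newton x) $ i \<le> u $ i"
proof -
  let ?e = "q - x" and ?t = "(1 + t)\<^sup>2 - 1"
  have e0: "0 \<le> ?e $ i" for i using x by simp
  have "0 \<le> (u - ?t *\<^sub>R (q - newton x)) $ i"
  proof (rule I_minus_B_inverse_nonneg[OF x])
    fix i
    have eq: "((mat 1 - B x) *v (u - ?t *\<^sub>R (q - newton x))) $ i =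
          ((mat 1 - B (q - ?e)) *v u) $ i - ?t * ((mat 1 - B x) *v (q - newton x)) $ i"
      by (simp add: matrix_vector_mult_diff_distrib matrix_vector_mult_scaleR)
    show "0 \<le> ((mat 1 - B x) *v (u - ?t *\<^sub>R (q - newton x))) $ i"
    proof (cases "i \<in> Q")
      case True
      \<comment> \<open>As \<open>?t\<close> is \<open>2 * t + t\<^sup>2\<close>, the left side
        splits into \<open>(t * d) * (t * d')\<close>, \<open>d * (t * d')\<close> and
        \<open>d' * (t * d)\<close>, matching the three terms of \<open>I_minus_B_u\<close>.\<close>
      have "?t * (d * d') \<le> v * v' + d * v' + d' * v"
        if "0 \<le> d" "0 \<le> d'" "t * d \<le> v" "t * d' \<le> v'" for d d' v v'
      proof -
        have "(t * d) * (t * d') \<le> v * v'"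
          by (rule mult_mono) (use that t order.trans[of 0 "t * d" v] in auto)
        moreover have "d * (t * d') \<le> d * v'" "d' * (t * d) \<le> d' * v"
          by (intro mult_left_mono that)+
        ultimately show ?thesis by (simp add: power2_eq_square algebra_simps)
      qed
      from this[OF e0 e0 e e] show ?thesis using True
        unfolding eq I_minus_B_u newton_error_equation[OF x] by simp
    next
      case False
      then show ?thesis using row_sum[of i]
        unfolding eq I_minus_B_u newton_error_equation[OF x] by simp
    qed
  qed
  then show ?thesis by simp
qed

lemma newton_iterates_invariant:
  "(\<forall>i. 0 \<le> (newton ^^ k) 0 $ i) \<and> (\<forall>i. (newton ^^ k) 0 $ i \<le> q $ i)
   \<and> (\<forall>i. (newton ^^ k) 0 $ i \<le> F ((newton ^^ k) 0) $ i)"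
  by (induction k) (use newton_invariant F_nonneg[of 0] q_pos in \<open>auto intro: less_imp_le\<close>)

text \<open>Writing the error factor as a power minus 1, each step squares the power. The start at 0
  uses \<open>q $ i < 1\<close>.\<close>

lemma newton_iterates_error:
  assumes "0 \<le> t" "\<And>i. t \<le> u $ i"
  shows "((1 + t) ^ (2 ^ k) - 1) * (q - (newton ^^ k) 0) $ i \<le> u $ i"
proof (induction k arbitrary: i)
  case 0
  have "t * q $ i \<le> t * 1" using assms q_less_1[of i] by (intro mult_left_mono) auto
  then show ?case using assms(2)[of i] by simp
next
  case (Suc k)
  have "(1 + ((1 + t) ^ (2 ^ k) - 1))\<^sup>2 = (1 + t) ^ (2 ^ Suc k)"
    by (simp add: power_mult[symmetric] mult.commute)
  moreover have "0 \<le> (1 + t) ^ (2 ^ k) - 1" using assms(1) by simp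
  ultimately show ?case
    using newton_contraction[of "(newton ^^ k) 0" "(1 + t) ^ (2 ^ k) - 1" i]
      newton_iterates_invariant[of k] Suc by simp
qed

end

section \<open>A lower bound on \<open>1 - q\<close>\<close>

text \<open>A feasible point with the most tight constraints is a vertex: were there a nonzero
  direction orthogonal to all tight normals, moving along it would make a further constraint
  tight.\<close>

lemma polyhedron_vertex:
  fixes a :: "'i \<Rightarrow> real ^ 'n" and b :: "'i \<Rightarrow> real"
  assumes "finite I" and feasible: "\<And>i. i \<in> I \<Longrightarrow> b i \<le> a i \<bullet> w0"
    and pointed: "\<And>h. (\<And>i. i \<in> I \<Longrightarrow> a i \<bullet> h = 0) \<Longrightarrow> h = 0"
  obtains w and \<sigma> :: "'n \<Rightarrow> 'i"
  where "\<And>i. i \<in> I \<Longrightarrow> b i \<le> a i \<bullet> w" "inj \<sigma>" "range \<sigma> \<subseteq> I"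
    "\<And>j. a (\<sigma> j) \<bullet> w = b (\<sigma> j)" "det (\<chi> j. a (\<sigma> j)) \<noteq> 0"
proof -
  define feas where "feas w \<longleftrightarrow> (\<forall>i\<in>I. b i \<le> a i \<bullet> w)" for w
  define tight where "tight w = {i \<in> I. a i \<bullet> w = b i}" for w
  have fin: "finite (tight w)" for w using \<open>finite I\<close> by (simp add: tight_def)
  have "\<forall>w. feas w \<longrightarrow> card (tight w) < Suc (card I)"
    using \<open>finite I\<close> by (auto simp: tight_def less_Suc_eq_le intro: card_mono)
  moreover have "feas w0" using feasible by (simp add: feas_def)
  ultimately obtain w where w: "feas w" and max: "\<And>w'. feas w' \<Longrightarrow> card (tight w') \<le> card (tight w)"
    using ex_has_greatest_nat[of feas w0 "\<lambda>w. card (tight w)"] by blast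
  have full: "h = 0" if h: "\<And>i. i \<in> tight w \<Longrightarrow> a i \<bullet> h = 0" for h
  proof (rule ccontr)
    assume "h \<noteq> 0"
    then obtain i0 where i0: "i0 \<in> I" "a i0 \<bullet> h \<noteq> 0" using pointed by blast
    \<comment> \<open>The sign is chosen so that some constraint decreases and eventually stops the
      motion.\<close>
    define h' where "h' = (if a i0 \<bullet> h < 0 then h else - h)"
    have h': "a i0 \<bullet> h' < 0" "\<And>i. i \<in> tight w \<Longrightarrow> a i \<bullet> h' = 0"
      using i0 h by (auto simp: h'_def)
    define N where "N = {i \<in> I. a i \<bullet> h' < 0}"
    have N: "finite N" "i0 \<in> N" using \<open>finite I\<close> i0 h' by (auto simp: N_def)
    let ?s = "\<lambda>i. (a i \<bullet> w - b i) / (- (a i \<bullet> h'))"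
    \<comment> \<open>Ratio test: the step length at which the first decreasing constraint becomes
      tight.\<close>
    define s where "s = Min (?s ` N)"
    have "s \<in> ?s ` N" unfolding s_def using N by (intro Min_in) auto
    then obtain i1 where i1: "i1 \<in> N" "s = ?s i1" by blast
    have s_le: "s \<le> ?s i" if "i \<in> N" for i using N that by (auto simp: s_def)
    have "0 \<le> s" unfolding i1(2) by (intro divide_nonneg_pos) (use i1 w in \<open>auto simp: N_def feas_def\<close>)
    have "feas (w + s *\<^sub>R h')" unfolding feas_def
    proof
      fix i assume "i \<in> I"
      then have "b i \<le> a i \<bullet> w" using w by (simp add: feas_def)
      show "b i \<le> a i \<bullet> (w + s *\<^sub>R h')"
      proof (cases "i \<in> N")
        case True
        then have "0 < - (a i \<bullet> h')" by (simp add: N_def)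
        then have "s * (- (a i \<bullet> h')) \<le> a i \<bullet> w - b i" using s_le[OF True] by (simp only: pos_le_divide_eq)
        then show ?thesis by (simp add: inner_add_right)
      next
        case False
        then have "0 \<le> s * (a i \<bullet> h')" using \<open>i \<in> I\<close> \<open>0 \<le> s\<close> by (simp add: N_def)
        then show ?thesis using \<open>b i \<le> _\<close> by (simp add: inner_add_right)
      qed
    qed
    moreover have "tight w \<union> {i1} \<subseteq> tight (w + s *\<^sub>R h')"
    proof -
      have "s * (a i1 \<bullet> h') = b i1 - a i1 \<bullet> w" using i1 by (simp add: N_def field_simps)
      then have "a i1 \<bullet> (w + s *\<^sub>R h') = b i1" by (simp only: inner_add_right inner_scaleR_right)
      then have "i1 \<in> tight (w + s *\<^sub>R h')" using i1(1) by (simp add: tight_def N_def)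
      moreover have "tight w \<subseteq> tight (w + s *\<^sub>R h')"
        using h'(2) by (auto simp: tight_def inner_add_right)
      ultimately show ?thesis by simp
    qed
    moreover have "i1 \<notin> tight w" using h'(2) i1 by (force simp: N_def)
    ultimately have "Suc (card (tight w)) \<le> card (tight (w + s *\<^sub>R h'))"
      using fin card_mono[OF fin, of "tight w \<union> {i1}" "w + s *\<^sub>R h'"] by simp
    then show False using max \<open>feas (w + s *\<^sub>R h')\<close> by fastforce
  qed
  have span: "span (a ` tight w) = UNIV"
  proof (rule ccontr)
    assume "span (a ` tight w) \<noteq> UNIV"
    then obtain h where "h \<noteq> 0" "\<forall>x\<in>span (a ` tight w). h \<bullet> x = 0"
      using span_not_UNIV_orthogonal by blast
    then show False using full[of h] by (auto simp: span_base inner_commute)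
  qed
  \<comment> \<open>A basis chosen among the tight normals gives the rows of an invertible square
    system.\<close>
  obtain V where V: "V \<subseteq> a ` tight w" "independent V" "a ` tight w \<subseteq> span V" "card V = dim (a ` tight w)"
    using basis_exists by blast
  have spanV: "span V = UNIV"
    using span span_minimal[OF V(3) subspace_span] by blast
  have "card V = card (UNIV :: 'n set)" using V(4) span by (metis dim_span dim_UNIV DIM_cart DIM_real mult_1_right)
  moreover have "finite V" using V(1) fin finite_surj by blast
  ultimately obtain g where g: "bij_betw g (UNIV :: 'n set) V"
    by (metis finite_same_card_bij finite)
  have "\<forall>j. \<exists>i. i \<in> tight w \<and> a i = g j"
    using g V(1) by (metis bij_betwE imageE subsetD UNIV_I)
  then obtain \<sigma> where \<sigma>: "\<And>j. \<sigma> j \<in> tight w" "\<And>j. a (\<sigma> j) = g j" by metis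
  show thesis
  proof
    show "b i \<le> a i \<bullet> w" if "i \<in> I" for i using w that by (simp add: feas_def)
    show "inj \<sigma>" using g \<sigma>(2) by (metis bij_betw_imp_inj_on inj_def)
    show "range \<sigma> \<subseteq> I" "a (\<sigma> j) \<bullet> w = b (\<sigma> j)" for j using \<sigma>(1) by (auto simp: tight_def)
    have "x = 0" if "(\<chi> j. a (\<sigma> j)) *v x = 0" for x
    proof -
      have "g j \<bullet> x = 0" for j
        using arg_cong[OF that, of "\<lambda>v. v $ j"] by (simp add: matrix_vector_mul_component \<sigma>(2))
      then have "orthogonal x y" if "y \<in> V" for y
        using that g unfolding orthogonal_def by (metis bij_betw_imp_surj_on imageE inner_commute)
      then have "orthogonal x x" using orthogonal_to_span[of x V x] spanV by blast
      then show ?thesis by (simp add: orthogonal_def)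
    qed
    then show "det (\<chi> j. a (\<sigma> j)) \<noteq> 0"
      by (metis invertible_det_nz invertible_left_inverse matrix_left_invertible_ker)
  qed
qed

text \<open>Cramer's rule after clearing the denominators \<open>D j\<close> of the rows.\<close>

lemma linear_system_solution_bound:
  fixes A :: "real ^ 'n ^ 'n" and D :: "'n \<Rightarrow> nat"
  assumes A: "det A \<noteq> 0" "\<And>i. (A *v w) $ i = b $ i"
    and int: "\<And>i. 0 < D i" "\<And>i j. real (D i) * A $ i $ j \<in> \<int>"
    and row: "\<And>i. \<bar>b $ i\<bar> + (\<Sum>j\<in>UNIV. \<bar>A $ i $ j\<bar>) \<le> 4"
  shows "\<bar>w $ k\<bar> \<le> 4 ^ CARD('n) * real (\<Prod>i\<in>UNIV. D i)"
proof -
  let ?C = "\<chi> i j. if j = k then b $ i else A $ i $ j"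
  have "A *v w = b" using A(2) by (simp add: vec_eq_iff)
  then have "w = (\<chi> k. det (\<chi> i j. if j = k then b $ i else A $ i $ j) / det A)"
    using cramer[OF A(1), of w b] by simp
  then have "w $ k = det ?C / det A" by (metis (no_types, lifting) vec_lambda_beta)
  then have wk: "\<bar>w $ k\<bar> * \<bar>det A\<bar> = \<bar>det ?C\<bar>" using A(1) by (simp add: abs_divide)
  have "(\<Sum>j\<in>UNIV. \<bar>?C $ i $ j\<bar>) \<le> 4" for i
  proof -
    have "(\<Sum>j\<in>UNIV. \<bar>?C $ i $ j\<bar>) \<le> (\<Sum>j\<in>UNIV. (if j = k then \<bar>b $ i\<bar> else 0) + \<bar>A $ i $ j\<bar>)"
      by (intro sum_mono) auto
    then show ?thesis using row[of i] by (simp add: sum.distrib)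
  qed
  then have "\<bar>det ?C\<bar> \<le> (\<Prod>i\<in>(UNIV::'n set). 4)"
    by (intro order_trans[OF real_abs.det] prod_mono) (auto intro: sum_nonneg)
  then have C: "\<bar>det ?C\<bar> \<le> 4 ^ CARD('n)" by simp
  \<comment> \<open>With its rows scaled by \<open>D i\<close>, the nonzero determinant becomes an
    integer, which bounds \<open>\<bar>det A\<bar>\<close> from below.\<close>
  have "det (\<chi> i. real (D i) *s A $ i) = (\<Prod>i\<in>UNIV. real (D i)) * det A"
    using det_rows_mul[of "\<lambda>i. real (D i)" "\<lambda>i. A $ i"] by simp
  moreover have "det (\<chi> i. real (D i) *s A $ i) \<in> \<int>"
    by (intro ints.det) (simp add: int)
  moreover have "(\<Prod>i\<in>UNIV. real (D i)) * det A \<noteq> 0" using A(1) int(1) by simp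
  ultimately have "1 \<le> \<bar>(\<Prod>i\<in>UNIV. real (D i)) * det A\<bar>" by (metis Ints_nonzero_abs_ge1)
  then have 1: "1 \<le> real (\<Prod>i\<in>UNIV. D i) * \<bar>det A\<bar>" by (simp add: abs_mult abs_prod)
  have "\<bar>w $ k\<bar> \<le> \<bar>w $ k\<bar> * (real (\<Prod>i\<in>UNIV. D i) * \<bar>det A\<bar>)"
    using mult_left_mono[OF 1, of "\<bar>w $ k\<bar>"] by simp
  also have "\<dots> = \<bar>det ?C\<bar> * real (\<Prod>i\<in>UNIV. D i)" using wk by (simp add: mult_ac)
  also have "\<dots> \<le> 4 ^ CARD('n) * real (\<Prod>i\<in>UNIV. D i)" using C by (intro mult_right_mono) (auto intro: prod_nonneg)
  finally show ?thesis .
qed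

context positive_least_fixpoint
begin

text \<open>
  Linearising the equations of \<open>u\<close> and scaling gives a feasible system of linear inequalities; its
  vertex, scaled back down, still yields a post-fixed point \<open>1 - z\<close> of \<open>F\<close>.
\<close>

lemma u_lower_bound:
  fixes D :: "'n \<Rightarrow> nat"
  assumes D: "\<And>i. 0 < D i" "\<And>i j. i \<notin> Q \<Longrightarrow> real (D i) * p i j \<in> \<int>" "\<And>i. i \<notin> Q \<Longrightarrow> real (D i) * c i \<in> \<int>"
  shows "1 \<le> (4 ^ CARD('n) * real (\<Prod>i\<in>UNIV. D i))\<^sup>2 * u $ k"
proof -
  define M where "M = 4 ^ CARD('n) * real (\<Prod>i\<in>UNIV. D i)"
  define \<delta> where "\<delta> i = 1 - (\<Sum>j\<in>UNIV. p i j) - c i" for i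
  \<comment> \<open>A pair \<open>(i, False)\<close> stands for \<open>w $ i \<ge> 1\<close>. A pair
    \<open>(i, True)\<close> stands for \<open>w $ l i + w $ r i - w $ i \<ge> 1\<close> in a
    quadratic row, and for \<open>w $ i\<close> being at most its weighted sum in a linear row
    without slack.\<close>
  define I where "I = {(i, s). s \<longrightarrow> i \<in> Q \<or> \<delta> i = 0}"
  define a :: "'n \<times> bool \<Rightarrow> real ^ 'n" where
    "a = (\<lambda>(i, s). if s then B 1 $ i - axis i 1 else axis i 1)"
  define b :: "'n \<times> bool \<Rightarrow> real" where "b = (\<lambda>(i, s). if s \<and> i \<notin> Q then 0 else 1)"
  have a_coord: "a (i, False) \<bullet> h = h $ i" for i h by (simp add: a_def inner_axis')
  have a_row: "a (i, True) \<bullet> h = (if i \<in> Q then h $ l i + h $ r i else (\<Sum>j\<in>UNIV. p i j * h $ j)) - h $ i" for i h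
    using matrix_vector_mul_component[of "B 1" h i]
    by (simp add: a_def inner_diff_left inner_axis' B_mult one_index split: if_splits)
  define \<mu> where "\<mu> = Min (range (\<lambda>i. u $ i))"
  have \<mu>_le: "\<mu> \<le> u $ i" for i by (simp add: \<mu>_def)
  have "\<mu> \<in> range (\<lambda>i. u $ i)" unfolding \<mu>_def by (rule Min_in) auto
  then have \<mu>: "0 < \<mu>" "\<mu> < 1" using u_pos u_less_1 by auto
  \<comment> \<open>This scaling lifts the product \<open>u $ l i * u $ r i\<close>, which is at
    least \<open>\<mu>\<^sup>2\<close>, to at least 1.\<close>
  define s where "s = 1 / \<mu>\<^sup>2"
  have feasible: "b x \<le> a x \<bullet> (s *\<^sub>R u)" if "x \<in> I" for x
  proof -
    obtain i e where x: "x = (i, e)" by (cases x)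
    have "0 < s" using \<mu> by (simp add: s_def)
    have "1 \<le> s * \<mu>" using \<mu> by (simp add: s_def power2_eq_square)
    also have "s * \<mu> \<le> s * u $ i" using \<mu>_le \<open>0 < s\<close> by (intro mult_left_mono) auto
    finally have 1: "1 \<le> s * u $ i" .
    have "\<mu> * \<mu> \<le> u $ l i * u $ r i" using \<mu> u_pos by (intro mult_mono \<mu>_le) (auto intro: less_imp_le)
    then have "s * (\<mu> * \<mu>) \<le> s * (u $ l i * u $ r i)" using \<open>0 < s\<close> by (intro mult_left_mono) auto
    then have 2: "1 \<le> s * (u $ l i * u $ r i)" using \<mu> by (simp add: s_def power2_eq_square)
    show ?thesis
    proof (cases e)
      case False
      then show ?thesis using 1 by (simp add: x a_coord b_def)
    next
      case True
      show ?thesis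
      proof (cases "i \<in> Q")
        case iQ: True
        have "u $ l i + u $ r i - u $ i = u $ l i * u $ r i" using u_quadratic[OF iQ] by simp
        then show ?thesis using iQ True 2 by (simp add: x a_row b_def)
      next
        case iQ: False
        then have "\<delta> i = 0" using that True by (simp add: I_def x)
        then have "(\<Sum>j\<in>UNIV. p i j * u $ j) - u $ i = 0" using u_linear[OF iQ] by (simp add: \<delta>_def)
        then show ?thesis using iQ True by (simp add: x a_row b_def)
      qed
    qed
  qed
  have pointed: "h = 0" if "\<And>x. x \<in> I \<Longrightarrow> a x \<bullet> h = 0" for h
    using that[of "(_, False)"] by (simp add: I_def a_coord vec_eq_iff)
  have "\<exists>w (\<sigma> :: 'n \<Rightarrow> 'n \<times> bool). (\<forall>x\<in>I. b x \<le> a x \<bullet> w) \<and> inj \<sigma> \<and> range \<sigma> \<subseteq> I \<and>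
      (\<forall>j. a (\<sigma> j) \<bullet> w = b (\<sigma> j)) \<and> det (\<chi> j. a (\<sigma> j)) \<noteq> 0"
  proof (rule polyhedron_vertex[where a = a and b = b and I = I])
    show "h = 0" if "\<And>x. x \<in> I \<Longrightarrow> a x \<bullet> h = 0" for h
      using that by (rule pointed)
    show "b x \<le> a x \<bullet> (s *\<^sub>R u)" if "x \<in> I" for x
      using that by (rule feasible)
  qed (simp, blast)
  then obtain w and \<sigma> :: "'n \<Rightarrow> 'n \<times> bool"
    where w: "\<And>x. x \<in> I \<Longrightarrow> b x \<le> a x \<bullet> w" and \<sigma>: "inj \<sigma>" "range \<sigma> \<subseteq> I"
      and tight: "\<And>j. a (\<sigma> j) \<bullet> w = b (\<sigma> j)" and det: "det (\<chi> j. a (\<sigma> j)) \<noteq> 0"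
    by blast
  \<comment> \<open>Only linear rows with tag \<open>True\<close> need a denominator. Since
    \<open>\<sigma>\<close> is injective, each \<open>D i\<close> enters the product at most
    once.\<close>
  define D' where "D' = (\<lambda>(i, s). if s \<and> i \<notin> Q then D i else 1)"
  have D'_pos: "0 < D' x" for x using D(1) by (auto simp: D'_def split: prod.split)
  have B1: "0 \<le> B 1 $ i $ j" for i j by (auto simp: B_def p_nonneg)
  have B1_sum: "(\<Sum>j\<in>UNIV. B 1 $ i $ j) = (if i \<in> Q then 2 else (\<Sum>j\<in>UNIV. p i j))" for i
    using B_mult[of 1 1 i] by (simp add: matrix_vector_mult_def one_index)
  have "\<bar>w $ i\<bar> \<le> 4 ^ CARD('n) * real (\<Prod>j\<in>UNIV. D' (\<sigma> j))" for i
  proof (rule linear_system_solution_bound[OF det, where b = "\<chi> j. b (\<sigma> j)"])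
    show "((\<chi> j. a (\<sigma> j)) *v w) $ j = (\<chi> j. b (\<sigma> j)) $ j" for j
      by (simp add: matrix_vector_mul_component tight)
    show "0 < D' (\<sigma> j)" for j by (rule D'_pos)
    have "real (D' (i, e)) * a (i, e) $ j \<in> \<int>" for i e j
      using D(2) by (cases "i \<in> Q"; cases e) (auto simp: D'_def a_def B_def axis_def right_diff_distrib)
    then show "real (D' (\<sigma> i)) * (\<chi> j. a (\<sigma> j)) $ i $ j \<in> \<int>" for i j
      by (metis surj_pair vec_lambda_beta)
    have "\<bar>b (i, e)\<bar> + (\<Sum>j\<in>UNIV. \<bar>a (i, e) $ j\<bar>) \<le> 4" for i e
    proof (cases e)
      case True
      have "(\<Sum>j\<in>UNIV. \<bar>a (i, e) $ j\<bar>) \<le> (\<Sum>j\<in>UNIV. B 1 $ i $ j + (if j = i then 1 else 0))"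
        using B1[of i] True by (intro sum_mono) (auto simp: a_def axis_def abs_if)
      also have "\<dots> = (\<Sum>j\<in>UNIV. B 1 $ i $ j) + 1" by (simp add: sum.distrib)
      finally show ?thesis using row_sum[of i] c_nonneg[of i] True by (auto simp: B1_sum b_def split: if_splits)
    next
      case False
      have "(\<Sum>j\<in>UNIV. \<bar>a (i, e) $ j\<bar>) = (\<Sum>j\<in>UNIV. if j = i then 1 else 0)"
        using False by (intro sum.cong) (auto simp: a_def axis_def)
      then show ?thesis using False by (simp add: b_def)
    qed
    then show "\<bar>(\<chi> j. b (\<sigma> j)) $ i\<bar> + (\<Sum>j\<in>UNIV. \<bar>(\<chi> j. a (\<sigma> j)) $ i $ j\<bar>) \<le> 4" for i
      by (cases "\<sigma> i") simp
  qed
  moreover have "(\<Prod>j\<in>UNIV. D' (\<sigma> j)) \<le> (\<Prod>i\<in>UNIV. D i)"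
  proof -
    have "(\<Prod>j\<in>UNIV. D' (\<sigma> j)) = prod D' (range \<sigma>)" using \<sigma>(1) by (simp add: prod.reindex)
    also have "\<dots> \<le> prod D' (UNIV \<times> UNIV)" 
      using D'_pos by (intro dvd_imp_le prod_dvd_prod_subset prod_pos) auto
    also have "\<dots> = (\<Prod>i\<in>UNIV. \<Prod>e\<in>UNIV. D' (i, e))" by (simp add: prod.cartesian_product)
    also have "\<dots> \<le> (\<Prod>i\<in>UNIV. D i)"
      using D(1) by (intro prod_mono) (auto simp: D'_def UNIV_bool Suc_le_eq)
    finally show ?thesis .
  qed
  ultimately have "\<bar>w $ i\<bar> \<le> M" for i
    unfolding M_def by (meson mult_left_mono of_nat_mono order_trans zero_le_numeral zero_le_power)
  then have w_le: "w $ i \<le> M" for i by (meson abs_ge_self order_trans)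
  have w_ge: "1 \<le> w $ i" for i using w[of "(i, False)"] by (simp add: I_def b_def a_coord)
  have "1 \<le> M" using w_ge w_le order_trans by blast
  have D_le: "real (D i) \<le> M" for i
  proof -
    have "D i \<le> (\<Prod>i\<in>UNIV. D i)" using D(1) by (intro dvd_imp_le dvd_prodI) (auto intro: prod_pos)
    then have "real (D i) \<le> real (\<Prod>i\<in>UNIV. D i)" by (rule of_nat_mono)
    then have "1 * real (D i) \<le> 4 ^ CARD('n) * real (\<Prod>i\<in>UNIV. D i)"
      by (intro mult_mono) simp_all
    then show ?thesis by (simp add: M_def)
  qed
  \<comment> \<open>After division by \<open>M\<^sup>2\<close> the product
    \<open>z (l i) * z (r i)\<close> is at most \<open>1 / M\<^sup>2\<close>, which is covered by
    the surplus 1 of the linearised quadratic constraint.\<close>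
  define z where "z i = w $ i / M\<^sup>2" for i
  have z_pos: "0 < z i" for i using w_ge[of i] \<open>1 \<le> M\<close> by (simp add: z_def)
  have z_le: "z i \<le> 1 / M" for i
    using w_le[of i] \<open>1 \<le> M\<close> by (simp add: z_def divide_simps power2_eq_square)
  have "1 / M \<le> 1" using \<open>1 \<le> M\<close> by simp
  have "q $ k \<le> (\<chi> i. 1 - z i) $ k"
  proof (rule least_postfixpoint)
    show "0 \<le> (\<chi> i. 1 - z i) $ i" for i using z_le[of i] \<open>1 / M \<le> 1\<close> by simp
    show "F (\<chi> i. 1 - z i) $ i \<le> (\<chi> i. 1 - z i) $ i" for i
    proof (cases "i \<in> Q")
      case True
      have "1 \<le> w $ l i + w $ r i - w $ i" using w[of "(i, True)"] True by (simp add: I_def b_def a_row)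
      then have "1 / M\<^sup>2 \<le> (w $ l i + w $ r i - w $ i) / M\<^sup>2" by (intro divide_right_mono) auto
      then have "1 / M\<^sup>2 \<le> z (l i) + z (r i) - z i" by (simp add: z_def add_divide_distrib diff_divide_distrib)
      moreover have "z (l i) * z (r i) \<le> (1 / M) * (1 / M)"
        using z_le z_pos \<open>1 \<le> M\<close> by (intro mult_mono) (auto intro: less_imp_le)
      ultimately show ?thesis using True by (simp add: F_def power2_eq_square algebra_simps)
    next
      case False
      have "z i \<le> \<delta> i + (\<Sum>j\<in>UNIV. p i j * z j)"
      proof (cases "\<delta> i = 0")
        case True
        then have "w $ i \<le> (\<Sum>j\<in>UNIV. p i j * w $ j)"
          using w[of "(i, True)"] False by (simp add: I_def b_def a_row)
        then have "w $ i / M\<^sup>2 \<le> (\<Sum>j\<in>UNIV. p i j * w $ j) / M\<^sup>2" by (intro divide_right_mono) auto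
        then show ?thesis using True by (simp add: z_def sum_divide_distrib)
      next
        case nz: False
        \<comment> \<open>A positive slack becomes a positive integer when multiplied by
          \<open>D i\<close>, hence is at least \<open>1 / M\<close>, and alone dominates
          \<open>z i\<close>.\<close>
        have "0 < \<delta> i" using nz row_sum[of i] by (simp add: \<delta>_def)
        have "real (D i) * \<delta> i = real (D i) - (\<Sum>j\<in>UNIV. real (D i) * p i j) - real (D i) * c i"
          by (simp add: \<delta>_def algebra_simps sum_distrib_left)
        then have "real (D i) * \<delta> i \<in> \<int>" using D False by (simp add: ints.sum)
        then have "1 \<le> real (D i) * \<delta> i"
          using \<open>0 < \<delta> i\<close> D(1)[of i] Ints_nonzero_abs_ge1[of "real (D i) * \<delta> i"] by simp
        also have "\<dots> \<le> M * \<delta> i" using D_le \<open>0 < \<delta> i\<close> by (intro mult_right_mono) auto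
        finally have "1 / M \<le> \<delta> i" using \<open>1 \<le> M\<close> by (simp add: divide_simps mult.commute)
        moreover have "0 \<le> (\<Sum>j\<in>UNIV. p i j * z j)"
          using z_pos by (intro sum_nonneg mult_nonneg_nonneg p_nonneg) (auto intro: less_imp_le)
        ultimately show ?thesis using z_le[of i] by simp
      qed
      then show ?thesis using False by (simp add: F_def \<delta>_def algebra_simps sum_subtractf)
    qed
  qed
  then have "z k \<le> u $ k" by (simp add: u_def)
  have "1 \<le> M\<^sup>2 * z k" using w_ge[of k] \<open>1 \<le> M\<close> by (simp add: z_def)
  also have "\<dots> \<le> M\<^sup>2 * u $ k" using \<open>z k \<le> u $ k\<close> by (intro mult_left_mono) auto
  finally show ?thesis unfolding M_def .
qed

end

section \<open>Simple normal form\<close>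

text \<open>A product rather than a least common multiple, so that its size is controlled directly
  by the sum of the bit lengths.\<close>

definition row_denominator :: "'n::finite system \<Rightarrow> 'n \<Rightarrow> nat" where
  "row_denominator P i = (\<Prod>m\<in>Poly_Mapping.keys (P $ i). nat (snd (quotient_of (Poly_Mapping.lookup (P $ i) m))))"

lemma row_denominator_pos: "0 < row_denominator P i"
  unfolding row_denominator_def by (intro prod_pos) (simp add: quotient_of_denom_pos')

lemma row_denominator_coef: "real (row_denominator P i) * coef P i m \<in> \<int>"
proof (cases "m \<in> Poly_Mapping.keys (P $ i)")
  case True
  let ?x = "Poly_Mapping.lookup (P $ i) m"
  let ?d = "snd (quotient_of ?x)"
  have "nat ?d dvd row_denominator P i"
    unfolding row_denominator_def by (rule dvd_prodI) (use True in auto)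
  then obtain e where e: "row_denominator P i = nat ?d * e" by (elim dvdE)
  have "0 < ?d" by (rule quotient_of_denom_pos')
  have "?x = of_int (fst (quotient_of ?x)) / of_int ?d" by (metis quotient_of_div prod.collapse)
  then have "coef P i m = of_int (fst (quotient_of ?x)) / of_int ?d"
    by (metis of_rat_divide of_rat_of_int_eq)
  then have "real (row_denominator P i) * coef P i m = of_int (fst (quotient_of ?x)) * real e"
    using \<open>0 < ?d\<close> by (simp add: e)
  then show ?thesis by simp
qed (simp add: in_keys_iff)

text \<open>The factor \<open>2 ^ n\<close> is paid for by the summand \<open>n\<close> of the
  encoding size; it later helps to absorb \<open>4 ^ n\<close> and the 3 in
  \<open>3 * d\<close>.\<close>

lemma prod_row_denominator_le:
  fixes P :: "'n::finite system"
  shows "(\<Prod>i\<in>UNIV. row_denominator P i) * 2 ^ CARD('n) \<le> 2 ^ system_size P"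
proof -
  have "nat (snd (quotient_of x)) \<le> 2 ^ (rat_size x + k)" for x k
  proof -
    have "0 < snd (quotient_of x)" by (rule quotient_of_denom_pos')
    then have "snd (quotient_of x) \<le> 2 ^ nat (bitlen (snd (quotient_of x)))"
      using bitlen_bounds by fastforce
    also have "\<dots> \<le> 2 ^ (rat_size x + k)" by (intro power_increasing) (auto simp: rat_size_def)
    finally show ?thesis by (simp add: nat_le_iff)
  qed
  then have "row_denominator P i \<le> (\<Prod>m\<in>Poly_Mapping.keys (P $ i). 2 ^ (rat_size (Poly_Mapping.lookup (P $ i) m) + monomial_size m))" for i
    unfolding row_denominator_def by (intro prod_mono) auto
  then have "(\<Prod>i\<in>UNIV. row_denominator P i) \<le>
      (\<Prod>i\<in>UNIV. 2 ^ (\<Sum>m\<in>Poly_Mapping.keys (P $ i). rat_size (Poly_Mapping.lookup (P $ i) m) + monomial_size m))"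
    by (intro prod_mono) (auto simp: power_sum)
  then show ?thesis by (simp add: system_size_def power_add power_sum[symmetric])
qed

section \<open>Translation of the normal form\<close>

lemma eval_poly_superset:
  assumes "finite S" "Poly_Mapping.keys f \<subseteq> S"
  shows "eval_poly f x = (\<Sum>m\<in>S. of_rat (Poly_Mapping.lookup f m) * eval_monomial m x)"
  unfolding eval_poly_def by (rule sum.mono_neutral_left) (use assms in \<open>auto simp: in_keys_iff\<close>)

lemma inj_var: "inj var"
  by (auto simp: var_def inj_on_def dest!: arg_cong[of _ _ Poly_Mapping.keys])

lemma total_degree_var: "total_degree (var j) = 1"
  by (simp add: var_def total_degree_single)

lemma var_neq_0: "var j \<noteq> 0"
proof
  assume "var j = 0"
  then show False using total_degree_var[of j] by (simp add: total_degree_def)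
qed

lemma eval_monomial_var: "eval_monomial (var j) x = x $ j"
  by (simp add: var_def eval_monomial_single)

lemma lookup_linear:
  fixes \<phi> :: "'n::finite \<Rightarrow> rat" and c :: rat
  defines "f \<equiv> (\<Sum>j\<in>UNIV. Poly_Mapping.single (var j) (\<phi> j)) + Poly_Mapping.single 0 c"
  shows "Poly_Mapping.lookup f (var j) = \<phi> j" "Poly_Mapping.lookup f 0 = c"
    and "Poly_Mapping.keys f \<subseteq> insert 0 (range var)"
proof -
  have *: "Poly_Mapping.lookup f m = (\<Sum>j\<in>UNIV. if var j = m then \<phi> j else 0) + (if m = 0 then c else 0)" for m
    by (simp add: f_def lookup_add lookup_sum lookup_single when_def)
  show "Poly_Mapping.lookup f (var j) = \<phi> j" "Poly_Mapping.lookup f 0 = c"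
    unfolding * by (simp_all add: inj_eq[OF inj_var] var_neq_0)
  show "Poly_Mapping.keys f \<subseteq> insert 0 (range var)"
  proof
    fix m assume "m \<in> Poly_Mapping.keys f"
    then have "Poly_Mapping.lookup f m \<noteq> 0" by (simp add: in_keys_iff)
    moreover have "Poly_Mapping.lookup f m = 0" if "m \<notin> insert 0 (range var)"
      unfolding * using that by (auto intro!: sum.neutral)
    ultimately show "m \<in> insert 0 (range var)" by blast
  qed
qed

lemma simple_normal_form_degree:
  assumes "simple_normal_form P" "m \<in> Poly_Mapping.keys (P $ i)"
  shows "total_degree m \<le> 2"
proof -
  consider j k where "P $ i = Poly_Mapping.single (var j + var k) 1"
    | \<phi> c where "P $ i = (\<Sum>j\<in>UNIV. Poly_Mapping.single (var j) (\<phi> j)) + Poly_Mapping.single 0 c"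
    using assms(1) unfolding simple_normal_form_def by blast
  then show ?thesis
  proof cases
    case 1
    then show ?thesis using assms(2) by (simp add: total_degree_add total_degree_var)
  next
    case 2
    then have "m \<in> insert 0 (range var)" using lookup_linear(3)[of \<phi> c] assms(2) by auto
    then show ?thesis by (auto simp: total_degree_var) (simp add: total_degree_def)
  qed
qed

lemma simple_normal_form_system:
  fixes P :: "'n::finite system"
  assumes PPS: "is_PPS P" and snf: "simple_normal_form P"
  shows "\<exists>Q l r p c. quadratic_linear_system p c \<and> eval_system P = quadratic_linear_system.F Q l r p c \<and>
    (\<forall>i j. i \<notin> Q \<longrightarrow> real (row_denominator P i) * p i j \<in> \<int>) \<and>
    (\<forall>i. i \<notin> Q \<longrightarrow> real (row_denominator P i) * c i \<in> \<int>)"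
proof -
  define Q where "Q = {i. \<exists>j k. P $ i = Poly_Mapping.single (var j + var k) 1}"
  have "\<forall>i. \<exists>j k. i \<in> Q \<longrightarrow> P $ i = Poly_Mapping.single (var j + var k) 1" by (auto simp: Q_def)
  then have "\<exists>l. \<forall>i. \<exists>k. i \<in> Q \<longrightarrow> P $ i = Poly_Mapping.single (var (l i) + var k) 1" by (rule choice)
  then obtain l where "\<forall>i. \<exists>k. i \<in> Q \<longrightarrow> P $ i = Poly_Mapping.single (var (l i) + var k) 1" ..
  then have "\<exists>r. \<forall>i. i \<in> Q \<longrightarrow> P $ i = Poly_Mapping.single (var (l i) + var (r i)) 1" by (rule choice)
  then obtain r where quad: "\<And>i. i \<in> Q \<Longrightarrow> P $ i = Poly_Mapping.single (var (l i) + var (r i)) 1" by blast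
  \<comment> \<open>Zeros in the quadratic rows make the sign and row-sum conditions hold for every
    \<open>i\<close>.\<close>
  define p where "p i j = (if i \<in> Q then 0 else coef P i (var j))" for i j
  define c where "c i = (if i \<in> Q then 0 else coef P i 0)" for i
  have keys: "Poly_Mapping.keys (P $ i) \<subseteq> insert 0 (range var)" if iQ: "i \<notin> Q" for i
  proof -
    obtain \<phi> c' where "P $ i = (\<Sum>j\<in>UNIV. Poly_Mapping.single (var j) (\<phi> j)) + Poly_Mapping.single 0 c'"
      using iQ snf unfolding simple_normal_form_def Q_def by blast
    then show ?thesis using lookup_linear(3)[of \<phi> c'] by simp
  qed
  have sum_insert: "(\<Sum>m\<in>insert 0 (range var). g m) = (\<Sum>j\<in>UNIV. g (var j)) + g 0" for g :: "'n monomial \<Rightarrow> real"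
  proof -
    have "0 \<notin> range (var :: 'n \<Rightarrow> _)" using var_neq_0 by (metis imageE)
    then show ?thesis using sum.reindex[OF inj_var, of g] by simp
  qed
  have "quadratic_linear_system p c"
  proof
    show "0 \<le> p i j" "0 \<le> c i" for i j using PPS by (auto simp: p_def c_def is_PPS_def)
    show "(\<Sum>j\<in>UNIV. p i j) + c i \<le> 1" for i
    proof (cases "i \<in> Q")
      case False
      have "of_rat (\<Sum>m\<in>Poly_Mapping.keys (P $ i). Poly_Mapping.lookup (P $ i) m) \<le> (1::real)"
        using PPS by (simp add: is_PPS_def of_rat_le_1_iff)
      also have "of_rat (\<Sum>m\<in>Poly_Mapping.keys (P $ i). Poly_Mapping.lookup (P $ i) m) =
          (\<Sum>m\<in>insert 0 (range var). coef P i m)"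
        unfolding of_rat_sum by (rule sum.mono_neutral_left) (use keys[OF False] in \<open>auto simp: in_keys_iff\<close>)
      finally show ?thesis using False by (simp add: sum_insert p_def c_def)
    qed (simp add: p_def c_def)
  qed
  then interpret quadratic_linear_system Q l r p c .
  show ?thesis
  proof (intro exI conjI)
    show "quadratic_linear_system p c" by fact
    show "eval_system P = F"
    proof (intro ext, unfold vec_eq_iff, intro allI)
      fix x i
      show "eval_system P x $ i = F x $ i"
      proof (cases "i \<in> Q")
        case True
        then show ?thesis
          by (simp add: eval_system_def F_def eval_poly_def quad eval_monomial_add eval_monomial_var)
      next
        case False
        have "eval_poly (P $ i) x = (\<Sum>m\<in>insert 0 (range var). coef P i m * eval_monomial m x)"
          by (rule eval_poly_superset) (use keys[OF False] in auto)
        then show ?thesis using False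
          by (simp add: eval_system_def F_def sum_insert eval_monomial_var eval_monomial_0 p_def c_def)
      qed
    qed
  qed (auto simp: p_def c_def row_denominator_coef)
qed

section \<open>Logarithms and the final exponent\<close>

lemma ceil_log_bound:
  assumes "0 < k"
  shows "0 \<le> ceil_log k" "k \<le> 2 ^ nat (ceil_log k)"
proof -
  have "0 \<le> log 2 (real k)" using assms by simp
  then show 0: "0 \<le> ceil_log k" by (simp add: ceil_log_def le_ceiling_iff)
  have "real k = 2 powr log 2 (real k)" using assms by simp
  also have "\<dots> \<le> 2 powr real (nat (ceil_log k))" using 0 by (intro powr_mono) (auto simp: ceil_log_def)
  also have "\<dots> = real (2 ^ nat (ceil_log k))" by (simp add: powr_realpow)
  finally show "k \<le> 2 ^ nat (ceil_log k)" by (simp only: of_nat_le_iff)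
qed

text \<open>The default value 0 at \<open>b = 1\<close> is sound, since
  \<open>1 \<le> 2 ^ 2 ^ 0\<close>.\<close>

lemma ceil_log_log_bound:
  assumes "0 < b"
  shows "0 \<le> ceil_log_log b" "b \<le> 2 ^ (2 ^ nat (ceil_log_log b))"
proof -
  have "0 \<le> ceil_log_log b \<and> b \<le> 2 ^ (2 ^ nat (ceil_log_log b))"
  proof (cases "b \<le> 1")
    case False
    then have 1: "1 \<le> log 2 (real b)" by simp
    then have "0 \<le> log 2 (log 2 (real b))" by simp
    then have "0 \<le> \<lceil>log 2 (log 2 (real b))\<rceil>" using ceiling_mono by fastforce
    then have 0: "0 \<le> ceil_log_log b" using False by (simp only: ceil_log_log_def if_False)
    have "log 2 (real b) = 2 powr log 2 (log 2 (real b))" using 1 by simp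
    also have "\<dots> \<le> 2 powr real (nat (ceil_log_log b))"
      using 0 False by (intro powr_mono) (auto simp: ceil_log_log_def)
    also have "\<dots> = real (2 ^ nat (ceil_log_log b))" by (simp add: powr_realpow)
    finally have "2 powr log 2 (real b) \<le> 2 powr real (2 ^ nat (ceil_log_log b))" by (intro powr_mono) auto
    then have "real b \<le> real (2 ^ (2 ^ nat (ceil_log_log b)))"
      using False by (simp add: powr_realpow[of 2 "2 ^ _", simplified])
    then show ?thesis using 0 by (simp only: of_nat_le_iff)
  qed (use assms in \<open>simp add: ceil_log_log_def\<close>)
  then show "0 \<le> ceil_log_log b" "b \<le> 2 ^ (2 ^ nat (ceil_log_log b))" by auto
qed

text \<open>The left side will be the binary exponent of the gap and the right side
  \<open>2 ^ m\<close>, with \<open>N\<close>, \<open>T\<close>, \<open>L\<close> the powers of two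
  given by the three rounded logarithms.\<close>

lemma exponent_bound:
  fixes n S N T L :: nat
  assumes "0 < n" "0 < S" "n \<le> N" "S \<le> T" "0 < L"
  shows "1 + L + 3 ^ n * (2 + L + (S + 1) * (2 * n + 1)) < 4 * 8 ^ n * (N * T * L) ^ 28"
proof -
  define X where "X = N * T * L"
  have pos: "1 \<le> N" "1 \<le> T" "1 \<le> L" using assms by auto
  have "1 * L \<le> N * T * L" using pos by (intro mult_right_mono) auto
  then have LX: "L \<le> X" by (simp add: X_def)
  have "n * S * 1 \<le> N * T * L" using pos assms by (intro mult_mono) auto
  then have nSX: "n * S \<le> X" by (simp add: X_def)
  have "1 \<le> X" using LX pos by linarith
  have "(S + 1) * (2 * n + 1) \<le> (2 * S) * (3 * n)" using assms by (intro mult_mono) auto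
  then have "2 + L + (S + 1) * (2 * n + 1) \<le> 9 * X" using LX nSX pos by (simp add: mult_ac)
  then have Y: "3 ^ n * (2 + L + (S + 1) * (2 * n + 1)) \<le> 3 ^ n * (9 * X)" by (rule mult_left_mono) simp
  define Y where "Y = 3 ^ n * (2 + L + (S + 1) * (2 * n + 1))"
  have "Y \<le> 9 * (3 ^ n * X)" using Y by (simp only: Y_def mult_ac)
  moreover have "3 * X \<le> 3 ^ n * X"
    using power_increasing[of 1 n "3::nat"] assms by (intro mult_right_mono) auto
  moreover have "1 + L \<le> 2 * X" using LX \<open>1 \<le> X\<close> by linarith
  \<comment> \<open>With \<open>Z\<close> for \<open>3 ^ n * X\<close>, the factor 3 lets
    \<open>3 * X \<le> Z\<close> be used: \<open>3 * (1 + L) \<le> 6 * X \<le> 2 * Z\<close> and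
    \<open>3 * Y \<le> 27 * Z\<close>.\<close>
  moreover have "3 * (1 + L + Y) \<le> 29 * Z" if "Y \<le> 9 * Z" "3 * X \<le> Z" "1 + L \<le> 2 * X" for Z
  proof -
    have "3 * (1 + L) \<le> 3 * (2 * X)" by (rule mult_left_mono[OF that(3)]) simp
    then show ?thesis using that by simp
  qed
  ultimately have "3 * (1 + L + Y) \<le> 29 * (3 ^ n * X)" by blast
  also have "\<dots> < 32 * (3 ^ n * X)" using \<open>1 \<le> X\<close> by simp
  also have "\<dots> \<le> 12 * (8 ^ n * X)"
  proof -
    obtain n' where n': "n = Suc n'" using assms(1) by (cases n) auto
    have "(3::nat) ^ n' \<le> 8 ^ n'" by (intro power_mono) auto
    \<comment> \<open>For \<open>n = 1\<close> both sides are 96.\<close>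
    then have "32 * 3 ^ n \<le> 12 * (8::nat) ^ n" by (simp add: n')
    then have "32 * 3 ^ n * X \<le> 12 * 8 ^ n * X" by (rule mult_right_mono) simp
    then show ?thesis by (simp add: mult_ac)
  qed
  also have "\<dots> \<le> 12 * (8 ^ n * X ^ 28)" using \<open>1 \<le> X\<close> by (simp add: self_le_power)
  finally show ?thesis unfolding X_def Y_def by simp
qed

text \<open>With \<open>t = 2 ^ - (4 |P|)\<close>, Bernoulli's inequality shows that
  \<open>4 |P|\<close> squarings raise \<open>1 + t\<close> to at least 2, and \<open>h\<close> more
  raise it to \<open>2 ^ 2 ^ h\<close>.\<close>

lemma newton_iterate_error:
  fixes P :: "'n::finite system"
  assumes PPS: "is_PPS P" and snf: "simple_normal_form P" and lfp: "is_LFP P q"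
    and q: "\<And>i. 0 < q $ i" "\<And>i. q $ i < 1"
    and g: "4 * system_size P + h \<le> g"
  shows "newton_iterate P g $ k \<le> q $ k" "q $ k \<le> newton_iterate P g $ k + 2 * inverse (2 ^ (2 ^ h))"
proof -
  let ?S = "system_size P"
  obtain Q l r p c where sys: "quadratic_linear_system p c"
      and F: "eval_system P = quadratic_linear_system.F Q l r p c"
      and den: "\<And>i j. i \<notin> Q \<Longrightarrow> real (row_denominator P i) * p i j \<in> \<int>"
        "\<And>i. i \<notin> Q \<Longrightarrow> real (row_denominator P i) * c i \<in> \<int>"
    using simple_normal_form_system[OF PPS snf] by blast
  interpret quadratic_linear_system Q l r p c by (rule sys)
  interpret positive_least_fixpoint Q l r p c q
    by unfold_locales (use lfp q in \<open>auto simp: is_LFP_def F\<close>)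
  have "newton_step P = newton"
    by (rule ext) (simp add: newton_step_def newton_def F jacobian_F)
  then have iter: "newton_iterate P g = (newton ^^ g) 0" by (simp add: newton_iterate_def)
  then show "newton_iterate P g $ k \<le> q $ k" using newton_iterates_invariant by simp
  define x where "x = newton_iterate P g"
  have "0 \<le> q $ k - x $ k" using newton_iterates_invariant[of g] iter by (simp add: x_def)
  define t :: real where "t = 1 / 2 ^ (4 * ?S)"
  have "0 < t" by (simp add: t_def)
  have "t \<le> u $ i" for i
  proof -
    let ?D = "\<Prod>i\<in>UNIV. row_denominator P i"
    have "4 ^ CARD('n) * ?D = ?D * 2 ^ CARD('n) * 2 ^ CARD('n)"
      by (simp add: power_mult_distrib[symmetric])
    also have "\<dots> \<le> 2 ^ ?S * 2 ^ ?S"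
      by (intro mult_mono prod_row_denominator_le power_increasing) (auto simp: system_size_def)
    finally have "real (4 ^ CARD('n) * ?D) \<le> real (2 ^ ?S * 2 ^ ?S)" by (rule of_nat_mono)
    then have "4 ^ CARD('n) * real ?D \<le> 2 ^ (2 * ?S)" by (simp add: power_add mult_2)
    then have "(4 ^ CARD('n) * real ?D)\<^sup>2 \<le> (2 ^ (2 * ?S))\<^sup>2" by (rule power_mono) (simp add: prod_nonneg)
    then have "(4 ^ CARD('n) * real ?D)\<^sup>2 * u $ i \<le> 2 ^ (4 * ?S) * u $ i"
      using u_pos[of i] by (intro mult_right_mono) (auto simp: power_mult[symmetric] mult.commute)
    then have "1 \<le> 2 ^ (4 * ?S) * u $ i"
      using u_lower_bound[OF row_denominator_pos den, of i] by linarith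
    then show ?thesis by (simp add: t_def divide_simps mult.commute)
  qed
  then have err: "((1 + t) ^ (2 ^ g) - 1) * (q $ k - x $ k) \<le> u $ k"
    using newton_iterates_error[of t g k] \<open>0 < t\<close> iter by (simp add: x_def)
  have "2 = 1 + real (2 ^ (4 * ?S)) * t" by (simp add: t_def)
  also have "\<dots> \<le> (1 + t) ^ (2 ^ (4 * ?S))" using \<open>0 < t\<close> by (intro Bernoulli_inequality) simp
  finally have "2 ^ (2 ^ h) \<le> ((1 + t) ^ (2 ^ (4 * ?S))) ^ (2 ^ h)" by (rule power_mono) simp
  also have "\<dots> = (1 + t) ^ (2 ^ (4 * ?S + h))" by (simp add: power_mult[symmetric] power_add)
  also have "\<dots> \<le> (1 + t) ^ (2 ^ g)" using \<open>0 < t\<close> g by (intro power_increasing) auto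
  finally have "2 ^ (2 ^ h) - 1 \<le> (1 + t) ^ (2 ^ g) - 1" by simp
  then have "(2 ^ (2 ^ h) - 1) * (q $ k - x $ k) \<le> ((1 + t) ^ (2 ^ g) - 1) * (q $ k - x $ k)"
    using \<open>0 \<le> q $ k - x $ k\<close> by (rule mult_right_mono)
  then have 1: "(2 ^ (2 ^ h) - 1) * (q $ k - x $ k) \<le> 1" using err u_less_1[of k] by linarith
  \<comment> \<open>Replacing \<open>2 ^ 2 ^ h - 1\<close> by half of \<open>2 ^ 2 ^ h\<close>
    produces the factor 2 in the error.\<close>
  have "(2::real) ^ 1 \<le> 2 ^ (2 ^ h)" by (rule power_increasing) auto
  then have "(2 ^ (2 ^ h) / 2) * (q $ k - x $ k) \<le> (2 ^ (2 ^ h) - 1) * (q $ k - x $ k)"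
    using \<open>0 \<le> q $ k - x $ k\<close> by (intro mult_right_mono) auto
  then have "2 ^ (2 ^ h) * (q $ k - x $ k) \<le> 2" using 1 by simp
  then show "q $ k \<le> newton_iterate P g $ k + 2 * inverse (2 ^ (2 ^ h))"
    by (simp add: x_def field_simps)
qed

lemma LFP_rational_gap:
  fixes P :: "'n::finite system"
  assumes PPS: "is_PPS P" and snf: "simple_normal_form P" and lfp: "is_LFP P q"
    and q: "\<And>i. q $ i \<le> 1"
    and ab: "a \<le> b" "0 < b" and ne: "q $ k \<noteq> real a / real b"
    and m: "int m = 2 + 3 * int CARD('n)
           + 28 * (ceil_log CARD('n) + ceil_log (system_size P) + ceil_log_log b)"
  shows "2 * inverse (2 ^ (2 ^ m)) < \<bar>q $ k - real a / real b\<bar>"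
proof -
  interpret quadratic_PPS P
    by unfold_locales (use PPS simple_normal_form_degree[OF snf] in auto)
  let ?n = "CARD('n)" and ?S = "system_size P"
  have "0 < ?n" by simp
  then have "0 < ?S" by (simp add: system_size_def)
  define N T C where "N = nat (ceil_log ?n)" and "T = nat (ceil_log ?S)" and "C = nat (ceil_log_log b)"
  define L :: nat where "L = 2 ^ C"
  have "int m = int (2 + 3 * ?n + (N + T + C) * 28)"
    using m ceil_log_bound(1)[OF \<open>0 < ?n\<close>] ceil_log_bound(1)[OF \<open>0 < ?S\<close>] ceil_log_log_bound(1)[OF ab(2)]
    by (simp add: N_def T_def C_def)
  then have m': "m = 2 + 3 * ?n + (N + T + C) * 28" by (simp only: of_nat_eq_iff)
  have "(2::nat) ^ m = 2 ^ 2 * (2 ^ 3) ^ ?n * (2 ^ N * 2 ^ T * 2 ^ C) ^ 28"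
    unfolding m' by (simp only: power_add power_mult)
  moreover have "(2::nat) ^ 2 = 4" "(2::nat) ^ 3 = 8" by simp_all
  ultimately have pm: "(2::nat) ^ m = 4 * 8 ^ ?n * (2 ^ N * 2 ^ T * L) ^ 28" by (simp only: L_def)
  \<comment> \<open>Chosen so that \<open>2 * b * H \<le> 2 ^ E\<close>, by
    \<open>b \<le> 2 ^ L\<close>, \<open>3 \<le> 2 ^ 2\<close> and
    \<open>3 * d \<le> 2 ^ (|P| + 1)\<close>.\<close>
  define E where "E = 1 + L + 3 ^ ?n * (2 + L + (?S + 1) * (2 * ?n + 1))"
  have "E < 2 ^ m"
    unfolding E_def pm
    by (rule exponent_bound)
      (use ceil_log_bound(2)[OF \<open>0 < ?n\<close>] ceil_log_bound(2)[OF \<open>0 < ?S\<close>] \<open>0 < ?S\<close> in \<open>auto simp: N_def T_def L_def\<close>)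
  define d where "d = (\<Prod>i\<in>UNIV. row_denominator P i)"
  have "0 < d" unfolding d_def by (intro prod_pos row_denominator_pos)
  have d: "real d * coef P i m' \<in> \<int>" for i m'
  proof -
    have "row_denominator P i dvd d" unfolding d_def by (rule dvd_prodI) auto
    then obtain e where "d = row_denominator P i * e" by (elim dvdE)
    then have "real d * coef P i m' = real e * (real (row_denominator P i) * coef P i m')" by simp
    also have "\<dots> \<in> \<int>" by (intro Ints_mult row_denominator_coef) auto
    finally show ?thesis .
  qed
  let ?y = "\<bar>real b * q $ k - real a\<bar>"
  define H where "H = (3 * real b * (3 * real d) ^ (2 * ?n + 1)) ^ 3 ^ ?n"
  have y: "q $ k - real a / real b = (real b * q $ k - real a) / real b" using ab by (simp add: field_simps)
  have "3 * d \<le> 2 ^ (?S + 1)"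
  proof -
    have "2 * d \<le> d * 2 ^ ?n" using power_increasing[of 1 ?n "2::nat"] by (simp add: Suc_le_eq)
    then have "2 * d \<le> 2 ^ ?S" using prod_row_denominator_le[of P] unfolding d_def[symmetric] by (rule order_trans)
    then show ?thesis by simp
  qed
  then have "real (3 * d) \<le> real (2 ^ (?S + 1))" by (rule of_nat_mono)
  then have d3: "3 * real d \<le> 2 ^ (?S + 1)" by simp
  have "b \<le> 2 ^ L" using ceil_log_log_bound(2)[OF ab(2)] by (simp add: C_def L_def)
  then have "real b \<le> real (2 ^ L)" by (rule of_nat_mono)
  then have bL: "real b \<le> 2 ^ L" by simp
  have "3 * real b * (3 * real d) ^ (2 * ?n + 1) \<le> (2 ^ 2 * 2 ^ L) * (2 ^ (?S + 1)) ^ (2 * ?n + 1)"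
    using bL d3 by (intro mult_mono power_mono) auto
  also have "\<dots> = 2 ^ (2 + L + (?S + 1) * (2 * ?n + 1))" unfolding power_add power_mult ..
  finally have "H \<le> (2 ^ (2 + L + (?S + 1) * (2 * ?n + 1))) ^ 3 ^ ?n"
    unfolding H_def by (rule power_mono) simp
  then have "2 * real b * H \<le> (2 ^ 1 * 2 ^ L) * (2 ^ (2 + L + (?S + 1) * (2 * ?n + 1))) ^ 3 ^ ?n"
    using bL by (intro mult_mono) (auto simp: H_def)
  also have "\<dots> = 2 ^ E"
  proof -
    have "(2 ^ 1 * 2 ^ L) * (2 ^ W) ^ 3 ^ ?n = (2::real) ^ (1 + L + 3 ^ ?n * W)" for W
      by (simp add: power_add power_mult[symmetric] mult.commute)
    then show ?thesis unfolding E_def .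
  qed
  also have "\<dots> < 2 ^ 2 ^ m" using \<open>E < 2 ^ m\<close> by (intro power_strict_increasing) auto
  finally have bH: "2 * real b * H < 2 ^ 2 ^ m" .
  have "1 \<le> 3 * real b" "1 \<le> 3 * real d" using ab \<open>0 < d\<close> by auto
  then have "1 * 1 \<le> 3 * real b * (3 * real d) ^ (2 * ?n + 1)"
    by (intro mult_mono one_le_power) auto
  then have "1 \<le> H" unfolding H_def by (intro one_le_power) simp
  have "1 \<le> ?y * H"
  \<comment> \<open>\<open>gap_bound\<close> covers distances up to 1; beyond that
    \<open>H \<ge> 1\<close> is enough.\<close>
  proof (cases "?y \<le> 1")
    case True
    moreover have "real b * q $ k \<noteq> real a" using ne ab by (auto simp: field_simps)
    ultimately show ?thesis unfolding H_def
      by (intro gap_bound[OF \<open>0 < d\<close> d lfp q ab])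
  next
    case False
    then have "1 * 1 \<le> ?y * H" using \<open>1 \<le> H\<close> by (intro mult_mono) auto
    then show ?thesis by simp
  qed
  then have "2 * real b \<le> 2 * real b * (?y * H)" using ab by simp
  also have "\<dots> = ?y * (2 * real b * H)" by simp
  also have "\<dots> < ?y * 2 ^ 2 ^ m"
    using bH \<open>1 \<le> ?y * H\<close> by (intro mult_strict_left_mono) (auto simp: zero_less_abs_iff)
  finally have "2 * inverse (2 ^ (2 ^ m)) < ?y / real b" using ab by (simp add: field_simps)
  then show ?thesis unfolding y by simp
qed

theorem theoremC7:
  fixes P :: "'n::finite system"
    and q :: "real ^ 'n"
    and r :: real
    and a b g m :: nat
    and k :: 'n
  assumes "is_PPS P"
    and "simple_normal_form P"
    and "is_LFP P q"
    and "\<forall>i. 0 < q $ i \<and> q $ i < 1"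
    and "0 < a" and "0 < b" and "r = real a / real b" and "0 < r" and "r \<le> 1"
    and "int g = 32 * int (system_size P) + 4 + 6 * int CARD('n)
           + 56 * (ceil_log CARD('n) + ceil_log (system_size P) + ceil_log_log b)"
    and "int m = 2 + 3 * int CARD('n)
           + 28 * (ceil_log CARD('n) + ceil_log (system_size P) + ceil_log_log b)"
  shows "(q $ k > r \<longleftrightarrow> newton_iterate P g $ k > r) \<and>
         (q $ k < r \<longleftrightarrow> newton_iterate P g $ k + 2 * inverse (2 ^ (2 ^ m)) < r)"
proof -
  have q: "\<And>i. 0 < q $ i" "\<And>i. q $ i < 1" using assms(4) by auto
  \<comment> \<open>The given \<open>g\<close> equals \<open>32 |P| + 2 m\<close>, hence is at least
    the \<open>4 |P| + m\<close> steps for which the error bound holds.\<close>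
  have "int g = int (32 * system_size P + 2 * m)" using assms(10,11) by simp
  then have "4 * system_size P + m \<le> g" by linarith
  note error = newton_iterate_error[OF assms(1-3) q this, of k]
  have "real a = r * real b" using assms(6,7) by simp
  also have "\<dots> \<le> 1 * real b" using assms(9) by (intro mult_right_mono) auto
  finally have "a \<le> b" by simp
  have gap: "2 * inverse (2 ^ (2 ^ m)) < \<bar>q $ k - r\<bar>" if "q $ k \<noteq> r"
    using LFP_rational_gap[OF assms(1-3) less_imp_le[OF q(2)] \<open>a \<le> b\<close> assms(6) _ assms(11), of k] that assms(7)
    by simp
  \<comment> \<open>If \<open>q $ k = r\<close>, then \<open>r\<close> lies between the iterate and
    the iterate plus the error, so all four inequalities fail. Otherwise the gap exceeds the error,
    and the iterate and its upper bound fall on the right side of \<open>r\<close>.\<close>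
  show ?thesis using gap error by linarith
qed

end
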